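(* Let $A\in\mathbb{C}^{n\times N}$, let $S\subset\{1,\dots,N\}$ with $|S|=k$ such that $A_S$ has full column rank. Let $X\in\mathbb{R}^{N\times L}$ have all rows outside $S$ equal to zero and $X^S=\Sigma\Phi$, where $\Sigma\in\mathbb{R}^{k\times k}$ is a diagonal matrix with positive diagonal entries and $\Phi\in\mathbb{R}^{k\times L}$ has independent standard normal entries. Define $$A_L=\sqrt2\,\frac{\Gamma((L+1)/2)}{\Gamma(L/2)},\qquad \gamma=\frac{A_L}{3\sqrt L+2\sqrt k}.$$ If $\|A_S^\dagger a_\ell\|_2<\gamma$ for all $\ell\notin S$, then with probability at least $$1-\exp(-L/8)-k\exp(-A_L^2/8)$$ $X$ is the unique solution of $\min_Z\|Z\|_{2,1}$ subject to $AZ=AX$.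
   Context: $a_\ell$ is the $\ell$-th column of $A$, $A_S$ the submatrix of columns indexed by $S$, $A_S^\dagger=(A_S^*A_S)^{-1}A_S^*$. For $X\in\mathbb{C}^{N\times L}$, $X^j$ is its $j$-th row, $X^S$ the rows indexed by $S$, and $\|X\|_{2,1}=\sum_j\|X^j\|_2$. $\Gamma$ is the Gamma function. *)

theory Defs
  imports "HOL-Probability.Probability"
begin

text \<open>Matrices are functions nat => nat => _ with explicit dimension bounds (0-based indices).
  A is n x N (columns a_l = (%i. A i l)), matrices X, Z are N x L.\<close>

definition full_col_rank_on :: "(nat \<Rightarrow> nat \<Rightarrow> complex) \<Rightarrow> nat \<Rightarrow> nat set \<Rightarrow> bool" where
  "full_col_rank_on A n S \<longleftrightarrow>
     (\<forall>c :: nat \<Rightarrow> complex. (\<forall>i<n. (\<Sum>j\<in>S. A i j * c j) = 0) \<longrightarrow> (\<forall>j\<in>S. c j = 0))"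

definition adjS_apply :: "(nat \<Rightarrow> nat \<Rightarrow> complex) \<Rightarrow> nat \<Rightarrow> nat set \<Rightarrow> (nat \<Rightarrow> complex) \<Rightarrow> nat \<Rightarrow> complex" where
  "adjS_apply A n S y = (\<lambda>j. if j \<in> S then (\<Sum>i<n. cnj (A i j) * y i) else 0)"

definition AS_apply :: "(nat \<Rightarrow> nat \<Rightarrow> complex) \<Rightarrow> nat set \<Rightarrow> (nat \<Rightarrow> complex) \<Rightarrow> nat \<Rightarrow> complex" where
  "AS_apply A S c = (\<lambda>i. \<Sum>m\<in>S. A i m * c m)"

definition gram_inv_apply :: "(nat \<Rightarrow> nat \<Rightarrow> complex) \<Rightarrow> nat \<Rightarrow> nat set \<Rightarrow> (nat \<Rightarrow> complex) \<Rightarrow> nat \<Rightarrow> complex" where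
  "gram_inv_apply A n S w = (THE c. (\<forall>j. j \<notin> S \<longrightarrow> c j = 0) \<and>
        (\<forall>j\<in>S. adjS_apply A n S (AS_apply A S c) j = w j))"

definition pinvS_apply :: "(nat \<Rightarrow> nat \<Rightarrow> complex) \<Rightarrow> nat \<Rightarrow> nat set \<Rightarrow> (nat \<Rightarrow> complex) \<Rightarrow> nat \<Rightarrow> complex" where
  "pinvS_apply A n S b = gram_inv_apply A n S (adjS_apply A n S b)"

definition norm2S :: "nat set \<Rightarrow> (nat \<Rightarrow> complex) \<Rightarrow> real" where
  "norm2S S c = sqrt (\<Sum>j\<in>S. (cmod (c j))\<^sup>2)"

definition norm21 :: "nat \<Rightarrow> nat \<Rightarrow> (nat \<Rightarrow> nat \<Rightarrow> complex) \<Rightarrow> real" where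
  "norm21 N L Z = (\<Sum>j<N. sqrt (\<Sum>l<L. (cmod (Z j l))\<^sup>2))"

definition mat_mult :: "(nat \<Rightarrow> nat \<Rightarrow> complex) \<Rightarrow> nat \<Rightarrow> (nat \<Rightarrow> nat \<Rightarrow> complex) \<Rightarrow> nat \<Rightarrow> nat \<Rightarrow> complex" where
  "mat_mult A N Z = (\<lambda>i l. \<Sum>j<N. A i j * Z j l)"

definition unique_l21_solution ::
  "(nat \<Rightarrow> nat \<Rightarrow> complex) \<Rightarrow> nat \<Rightarrow> nat \<Rightarrow> nat \<Rightarrow> (nat \<Rightarrow> nat \<Rightarrow> complex) \<Rightarrow> bool" where
  "unique_l21_solution A n N L X \<longleftrightarrow>
     (let feas = {Z. \<forall>i<n. \<forall>l<L. mat_mult A N Z i l = mat_mult A N X i l} in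
       (\<forall>Z\<in>feas. norm21 N L X \<le> norm21 N L Z) \<and>
       (\<forall>Z\<in>feas. norm21 N L Z \<le> norm21 N L X \<longrightarrow> (\<forall>j<N. \<forall>l<L. Z j l = X j l)))"

definition gauss_entries :: "nat set \<Rightarrow> nat \<Rightarrow> ((nat \<times> nat) \<Rightarrow> real) measure" where
  "gauss_entries S L = PiM (S \<times> {..<L}) (\<lambda>_. density lborel std_normal_density)"

definition X_of :: "nat set \<Rightarrow> (nat \<Rightarrow> real) \<Rightarrow> ((nat \<times> nat) \<Rightarrow> real) \<Rightarrow> nat \<Rightarrow> nat \<Rightarrow> complex" where
  "X_of S \<sigma> \<Phi> = (\<lambda>j l. if j \<in> S then complex_of_real (\<sigma> j * \<Phi> (j, l)) else 0)"

definition A_const :: "nat \<Rightarrow> real" where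
  "A_const L = sqrt 2 * Gamma ((real L + 1) / 2) / Gamma (real L / 2)"

end

theory Submission
  imports Defs
begin

text \<open>
  Let U be the matrix with rows \<open>\<Phi>\<^sub>j / \<parallel>\<Phi>\<^sub>j\<parallel>\<close>. If \<open>\<parallel>U\<^sup>T A\<^sub>S\<^sup>\<dagger> a\<^sub>m\<parallel> < 1\<close> for all \<open>m \<notin> S\<close>, then U is
  a dual certificate for X. Since \<open>A\<^sub>L \<le> \<surd>L\<close> by log-convexity of Gamma, it suffices that
  \<open>\<parallel>U\<parallel>\<^sup>2 \<le> 9 + 4 k / L\<close>, which fails with probability at most \<open>exp (- L / 8)\<close>: for a unit vector
  z, Jensen's inequality (the norm and the direction of a Gaussian vector are independent) bounds
  \<open>E exp (3/8 L \<langle>U\<^sub>j, z\<rangle>\<^sup>2)\<close> by \<open>E exp (3/8 g\<^sup>2) = 2\<close> with g standard normal, so \<open>\<parallel>U z\<parallel>\<^sup>2\<close> has a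
  Chernoff tail. A union bound over at most \<open>9\<^sup>L\<close> directions, given by integer points near the
  sphere of radius \<open>\<surd>L\<close>, then controls \<open>\<parallel>U\<^sup>T c\<parallel>\<close> for every c: if the direction z makes a small
  angle with \<open>U\<^sup>T c\<close>, then \<open>\<parallel>U\<^sup>T c\<parallel>\<close> is comparable to \<open>\<langle>U\<^sup>T c, z\<rangle> = \<langle>c, U z\<rangle> \<le> \<parallel>c\<parallel> \<parallel>U z\<parallel>\<close>.
  Normalising the rows first is what avoids Gaussian comparison and concentration inequalities.
\<close>

section \<open>Dual certificates\<close>

definition cinner :: "nat \<Rightarrow> (nat \<Rightarrow> complex) \<Rightarrow> (nat \<Rightarrow> complex) \<Rightarrow> complex" where
  "cinner n u v = (\<Sum>i<n. cnj (u i) * v i)"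

lemma cinner_diff_right: "cinner n u (\<lambda>i. v i - w i) = cinner n u v - cinner n u w"
  by (simp add: cinner_def right_diff_distrib sum_subtractf)

lemma cinner_add_left: "cinner n (\<lambda>i. u i + v i) w = cinner n u w + cinner n v w"
  by (simp add: cinner_def distrib_right sum.distrib)

lemma cinner_mult_right: "cinner n u (\<lambda>i. v i * c) = cinner n u v * c"
  by (simp add: cinner_def sum_distrib_right mult.assoc)

lemma cinner_sum_right:
  "cinner n u (\<lambda>i. \<Sum>m\<in>T. v m i * c m) = (\<Sum>m\<in>T. cinner n u (v m) * c m)"
  unfolding cinner_def sum_distrib_left sum_distrib_right mult.assoc by (rule sum.swap)

lemma cinner_sum_left:
  "cinner n (\<lambda>i. \<Sum>m\<in>T. v m i * c m) w = (\<Sum>m\<in>T. cinner n (v m) w * cnj (c m))"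
  unfolding cinner_def cnj_sum sum_distrib_right
  by (subst sum.swap) (simp add: mult_ac)

lemma cinner_self_eq_0_iff: "cinner n u u = 0 \<longleftrightarrow> (\<forall>i<n. u i = 0)"
proof -
  have "cinner n u u = complex_of_real (\<Sum>i<n. (cmod (u i))\<^sup>2)"
    by (simp add: cinner_def complex_norm_square[symmetric] mult.commute del: of_real_power)
  then show ?thesis
    by (auto simp: sum_nonneg_eq_0_iff simp del: of_real_sum of_real_power)
qed

lemma exists_orthogonal_component: "\<exists>t. cinner n e (\<lambda>i. r i - e i * t) = 0"
proof (cases "cinner n e e = 0")
  case True
  then have "\<forall>i<n. e i = 0" by (simp add: cinner_self_eq_0_iff)
  then show ?thesis by (simp add: cinner_def)
next
  case False
  then have "cinner n e (\<lambda>i. r i - e i * (cinner n e r / cinner n e e)) = 0"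
    by (subst cinner_diff_right, subst cinner_mult_right) simp
  then show ?thesis by blast
qed

lemma exists_orthogonal_residual:
  fixes a :: "'j \<Rightarrow> nat \<Rightarrow> complex"
  assumes "finite S"
  shows "\<exists>c. \<forall>j\<in>S. cinner n (a j) (\<lambda>i. b i - (\<Sum>m\<in>S. a m i * c m)) = 0"
  using assms
proof (induction S arbitrary: b rule: finite_induct)
  case empty
  then show ?case by simp
next
  case (insert k S)
  obtain c where "\<forall>j\<in>S. cinner n (a j) (\<lambda>i. b i - (\<Sum>m\<in>S. a m i * c m)) = 0"
    using insert.IH by blast
  moreover define r where "r = (\<lambda>i. b i - (\<Sum>m\<in>S. a m i * c m))"
  ultimately have a_r: "cinner n (a j) r = 0" if "j \<in> S" for j
    using that by blast
  obtain d where "\<forall>j\<in>S. cinner n (a j) (\<lambda>i. a k i - (\<Sum>m\<in>S. a m i * d m)) = 0"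
    using insert.IH by blast
  moreover define e where "e = (\<lambda>i. a k i - (\<Sum>m\<in>S. a m i * d m))"
  ultimately have a_e: "cinner n (a j) e = 0" if "j \<in> S" for j
    using that by blast
  obtain t where "cinner n e (\<lambda>i. r i - e i * t) = 0"
    using exists_orthogonal_component by blast
  moreover define res where "res = (\<lambda>i. r i - e i * t)"
  ultimately have e_res: "cinner n e res = 0"
    by simp
  have a_res: "cinner n (a j) res = 0" if "j \<in> S" for j
    using a_r a_e that by (simp add: res_def cinner_diff_right cinner_mult_right)
  have "a k = (\<lambda>i. e i + (\<Sum>m\<in>S. a m i * d m))"
    by (simp add: e_def)
  then have "cinner n (a k) res = cinner n e res + (\<Sum>m\<in>S. cinner n (a m) res * cnj (d m))"
    by (simp only: cinner_add_left cinner_sum_left)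
  then have ak_res: "cinner n (a k) res = 0"
    by (simp add: a_res e_res)
  define c' where "c' = (\<lambda>m. if m = k then t else c m - d m * t)"
  have "(\<Sum>m\<in>S. a m i * c' m) = (\<Sum>m\<in>S. a m i * c m - a m i * d m * t)" for i
    using insert.hyps by (intro sum.cong) (auto simp: c'_def algebra_simps)
  then have "(\<Sum>m\<in>S. a m i * c' m) = (\<Sum>m\<in>S. a m i * c m) - (\<Sum>m\<in>S. a m i * d m) * t" for i
    by (simp add: sum_subtractf sum_distrib_right)
  then have "(\<lambda>i. b i - (\<Sum>m\<in>insert k S. a m i * c' m)) = res"
    using insert.hyps
    by (simp add: fun_eq_iff res_def r_def e_def left_diff_distrib) (simp add: c'_def algebra_simps)
  then show ?case
    using a_res ak_res by (intro exI[of _ c']) simp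
qed

lemma full_col_rank_on_gram_eq_0:
  assumes "full_col_rank_on A n S"
    and "\<And>j. j \<in> S \<Longrightarrow> cinner n (\<lambda>i. A i j) (AS_apply A S d) = 0" and "j \<in> S"
  shows "d j = 0"
proof -
  have "cinner n (AS_apply A S d) (AS_apply A S d)
      = (\<Sum>m\<in>S. cinner n (\<lambda>i. A i m) (AS_apply A S d) * cnj (d m))"
    unfolding AS_apply_def by (rule cinner_sum_left)
  also have "\<dots> = 0" using assms(2) by simp
  finally have "\<forall>i<n. AS_apply A S d i = 0" by (simp add: cinner_self_eq_0_iff)
  then show ?thesis using assms(1,3) by (simp add: full_col_rank_on_def AS_apply_def)
qed

lemma pinvS_apply_normal_equation:
  assumes rank: "full_col_rank_on A n S" and "finite S" and "j \<in> S"
  shows "cinner n (\<lambda>i. A i j) (\<lambda>i. b i - AS_apply A S (pinvS_apply A n S b) i) = 0"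
proof -
  define normal_eq where
    "normal_eq = (\<lambda>c. \<forall>j\<in>S. cinner n (\<lambda>i. A i j) (\<lambda>i. b i - AS_apply A S c i) = 0)"
  have normal_eq_iff:
    "(\<forall>j\<in>S. adjS_apply A n S (AS_apply A S c) j = adjS_apply A n S b j) \<longleftrightarrow> normal_eq c" for c
    by (auto simp: normal_eq_def adjS_apply_def cinner_diff_right) (simp_all add: cinner_def)
  obtain c0 where "\<forall>j\<in>S. cinner n (\<lambda>i. A i j) (\<lambda>i. b i - (\<Sum>m\<in>S. A i m * c0 m)) = 0"
    using exists_orthogonal_residual[OF \<open>finite S\<close>, of n "\<lambda>j i. A i j" b] by blast
  moreover define c where "c = (\<lambda>j. if j \<in> S then c0 j else 0)"
  ultimately have c: "normal_eq c" "\<forall>j. j \<notin> S \<longrightarrow> c j = 0"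
    by (auto simp: normal_eq_def AS_apply_def)
  have c_unique: "x = c" if "\<forall>j. j \<notin> S \<longrightarrow> x j = 0" "normal_eq x" for x
  proof
    fix j
    have "x j - c j = 0" if "j \<in> S"
    proof (rule full_col_rank_on_gram_eq_0[OF rank _ that])
      fix m assume "m \<in> S"
      have "AS_apply A S (\<lambda>j. x j - c j) = (\<lambda>i. (b i - AS_apply A S c i) - (b i - AS_apply A S x i))"
        by (simp add: AS_apply_def right_diff_distrib sum_subtractf fun_eq_iff)
      then show "cinner n (\<lambda>i. A i m) (AS_apply A S (\<lambda>j. x j - c j)) = 0"
        using \<open>normal_eq x\<close> c(1) \<open>m \<in> S\<close>
        by (simp only: cinner_diff_right) (simp add: normal_eq_def cinner_diff_right)
    qed
    then show "x j = c j" using that(1) c(2) by (cases "j \<in> S") auto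
  qed
  have "pinvS_apply A n S b = c"
    unfolding pinvS_apply_def gram_inv_apply_def normal_eq_iff
    using c c_unique by (intro the_equality) blast+
  then show ?thesis using c(1) \<open>j \<in> S\<close> by (simp add: normal_eq_def)
qed

lemma kernel_eq_pinvS_apply:
  assumes rank: "full_col_rank_on A n S" and "S \<subseteq> {..<N}"
    and kernel: "\<And>i. i < n \<Longrightarrow> (\<Sum>j<N. A i j * h j) = 0" and "j \<in> S"
  shows "h j = - (\<Sum>m\<in>{..<N} - S. pinvS_apply A n S (\<lambda>i. A i m) j * h m)"
proof -
  let ?T = "{..<N} - S" and ?p = "\<lambda>m. pinvS_apply A n S (\<lambda>i. A i m)"
  have "finite S" using \<open>S \<subseteq> {..<N}\<close> finite_subset by blast
  define d where "d = (\<lambda>j. h j + (\<Sum>m\<in>?T. ?p m j * h m))"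
  define res where "res = (\<lambda>m i. A i m - AS_apply A S (?p m) i)"
  have residuals: "AS_apply A S d i = (\<Sum>m\<in>?T. res m i * - h m)" if "i < n" for i
  proof -
    have "(\<Sum>q\<in>S. A i q * h q) + (\<Sum>m\<in>?T. A i m * h m) = 0"
      using kernel[OF that] \<open>S \<subseteq> {..<N}\<close>
      by (subst (asm) sum.subset_diff[of S]) (auto simp: add.commute)
    moreover have "(\<Sum>q\<in>S. A i q * (\<Sum>m\<in>?T. ?p m q * h m)) = (\<Sum>m\<in>?T. AS_apply A S (?p m) i * h m)"
      unfolding AS_apply_def sum_distrib_left sum_distrib_right mult.assoc by (rule sum.swap)
    moreover have "AS_apply A S d i = (\<Sum>q\<in>S. A i q * h q) + (\<Sum>q\<in>S. A i q * (\<Sum>m\<in>?T. ?p m q * h m))"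
      by (simp add: AS_apply_def d_def distrib_left sum.distrib)
    ultimately show ?thesis
      by (simp add: res_def left_diff_distrib sum_subtractf sum_negf eq_neg_iff_add_eq_0)
  qed
  have "d j = 0"
  proof (rule full_col_rank_on_gram_eq_0[OF rank _ \<open>j \<in> S\<close>])
    fix q assume "q \<in> S"
    have "cinner n (\<lambda>i. A i q) (AS_apply A S d) = cinner n (\<lambda>i. A i q) (\<lambda>i. \<Sum>m\<in>?T. res m i * - h m)"
      by (simp add: cinner_def residuals)
    also have "\<dots> = (\<Sum>m\<in>?T. cinner n (\<lambda>i. A i q) (res m) * - h m)"
      by (rule cinner_sum_right)
    also have "\<dots> = 0"
      using pinvS_apply_normal_equation[OF rank \<open>finite S\<close> \<open>q \<in> S\<close>] by (simp add: res_def)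
    finally show "cinner n (\<lambda>i. A i q) (AS_apply A S d) = 0" .
  qed
  then show ?thesis by (simp add: d_def eq_neg_iff_add_eq_0)
qed

lemma norm2S_eq_L2_set: "norm2S I x = L2_set (\<lambda>i. cmod (x i)) I"
  by (simp add: norm2S_def L2_set_def)

lemma norm2S_nonneg: "0 \<le> norm2S I x"
  by (simp add: norm2S_eq_L2_set)

lemma cmod_sum_mult_le_norm2S: "cmod (\<Sum>i\<in>I. x i * y i) \<le> norm2S I x * norm2S I y"
proof -
  have "cmod (\<Sum>i\<in>I. x i * y i) \<le> (\<Sum>i\<in>I. \<bar>cmod (x i)\<bar> * \<bar>cmod (y i)\<bar>)"
    by (rule order_trans[OF norm_sum]) (simp add: norm_mult)
  also have "\<dots> \<le> norm2S I x * norm2S I y"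
    unfolding norm2S_eq_L2_set by (rule L2_set_mult_ineq)
  finally show ?thesis .
qed

lemma norm2S_add_ge_subgradient:
  assumes "norm2S I u \<le> 1" and "(\<Sum>i\<in>I. u i * x i) = complex_of_real (norm2S I x)"
  shows "norm2S I x + Re (\<Sum>i\<in>I. u i * h i) \<le> norm2S I (\<lambda>i. x i + h i)"
proof -
  have "norm2S I x + Re (\<Sum>i\<in>I. u i * h i) = Re (\<Sum>i\<in>I. u i * (x i + h i))"
    using arg_cong[OF assms(2), of Re] by (simp add: distrib_left sum.distrib)
  also have "\<dots> \<le> cmod (\<Sum>i\<in>I. u i * (x i + h i))" by (rule complex_Re_le_cmod)
  also have "\<dots> \<le> norm2S I u * norm2S I (\<lambda>i. x i + h i)" by (rule cmod_sum_mult_le_norm2S)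
  also have "\<dots> \<le> norm2S I (\<lambda>i. x i + h i)"
    using assms(1) by (rule mult_left_le_one_le[OF norm2S_nonneg norm2S_nonneg])
  finally show ?thesis .
qed

lemma norm21_eq_sum_norm2S: "norm21 N L Z = (\<Sum>j<N. norm2S {..<L} (Z j))"
  by (simp add: norm21_def norm2S_def)

lemma norm21_cong: "(\<And>j l. j < N \<Longrightarrow> l < L \<Longrightarrow> Y j l = Z j l) \<Longrightarrow> norm21 N L Y = norm21 N L Z"
  by (simp add: norm21_def)

lemma norm21_eq_0_iff: "norm21 N L Z = 0 \<longleftrightarrow> (\<forall>j<N. \<forall>l<L. Z j l = 0)"
  by (auto simp: norm21_eq_sum_norm2S norm2S_eq_L2_set sum_nonneg_eq_0_iff L2_set_eq_0_iff)

definition mat_kernel :: "(nat \<Rightarrow> nat \<Rightarrow> complex) \<Rightarrow> nat \<Rightarrow> nat \<Rightarrow> nat \<Rightarrow> (nat \<Rightarrow> nat \<Rightarrow> complex) set" where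
  "mat_kernel A n N L = {H. \<forall>i<n. \<forall>l<L. mat_mult A N H i l = 0}"

lemma unique_l21_solution_iff:
  "unique_l21_solution A n N L X \<longleftrightarrow>
   (\<forall>H\<in>mat_kernel A n N L. norm21 N L H \<noteq> 0 \<longrightarrow> norm21 N L X < norm21 N L (\<lambda>j l. X j l + H j l))"
  (is "_ \<longleftrightarrow> ?growth")
proof -
  let ?feasible = "{Z. \<forall>i<n. \<forall>l<L. mat_mult A N Z i l = mat_mult A N X i l}"
  have feasible_iff: "Z \<in> ?feasible \<longleftrightarrow> (\<lambda>j l. Z j l - X j l) \<in> mat_kernel A n N L" for Z
    by (simp add: mat_kernel_def mat_mult_def right_diff_distrib sum_subtractf)
  show ?thesis
  proof
    assume unique: "unique_l21_solution A n N L X"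
    show ?growth
    proof (intro ballI impI)
      fix H assume "H \<in> mat_kernel A n N L" "norm21 N L H \<noteq> 0"
      then have "(\<lambda>j l. X j l + H j l) \<in> ?feasible" "\<not> (\<forall>j<N. \<forall>l<L. X j l + H j l = X j l)"
        by (simp_all add: feasible_iff norm21_eq_0_iff del: mem_Collect_eq)
      then show "norm21 N L X < norm21 N L (\<lambda>j l. X j l + H j l)"
        using unique unfolding unique_l21_solution_def Let_def not_less[symmetric] by blast
    qed
  next
    assume growth: ?growth
    have growth_or_eq: "norm21 N L X < norm21 N L Z \<or> (\<forall>j<N. \<forall>l<L. Z j l = X j l)"
      if "Z \<in> ?feasible" for Z
      using growth that unfolding feasible_iff by (force simp: norm21_eq_0_iff)
    have norm21_eq: "norm21 N L Z = norm21 N L X" if "\<forall>j<N. \<forall>l<L. Z j l = X j l" for Z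
      using that by (intro norm21_cong) auto
    have "norm21 N L X \<le> norm21 N L Z \<and>
        (norm21 N L Z \<le> norm21 N L X \<longrightarrow> (\<forall>j<N. \<forall>l<L. Z j l = X j l))" if "Z \<in> ?feasible" for Z
      using growth_or_eq[OF that] norm21_eq[of Z] by auto
    then show "unique_l21_solution A n N L X"
      unfolding unique_l21_solution_def Let_def by blast
  qed
qed

lemma mat_kernel_rows_eq:
  assumes "full_col_rank_on A n S" "S \<subseteq> {..<N}" "H \<in> mat_kernel A n N L" "j \<in> S" "l < L"
  shows "H j l = - (\<Sum>m\<in>{..<N} - S. pinvS_apply A n S (\<lambda>i. A i m) j * H m l)"
  using assms(3,5)
  by (intro kernel_eq_pinvS_apply[OF assms(1,2) _ assms(4)]) (simp add: mat_kernel_def mat_mult_def)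

definition certificate_column ::
  "(nat \<Rightarrow> nat \<Rightarrow> complex) \<Rightarrow> nat \<Rightarrow> nat set \<Rightarrow> (nat \<Rightarrow> nat \<Rightarrow> complex) \<Rightarrow> nat \<Rightarrow> nat \<Rightarrow> complex" where
  "certificate_column A n S U m l = (\<Sum>j\<in>S. U j l * pinvS_apply A n S (\<lambda>i. A i m) j)"

lemma sum_mult_mat_kernel:
  assumes "full_col_rank_on A n S" "S \<subseteq> {..<N}" "H \<in> mat_kernel A n N L"
  shows "(\<Sum>j\<in>S. \<Sum>l<L. U j l * H j l)
       = - (\<Sum>m\<in>{..<N} - S. \<Sum>l<L. certificate_column A n S U m l * H m l)"
proof -
  let ?T = "{..<N} - S" and ?p = "\<lambda>m. pinvS_apply A n S (\<lambda>i. A i m)"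
  have "(\<Sum>j\<in>S. \<Sum>l<L. U j l * H j l) = (\<Sum>l<L. \<Sum>j\<in>S. U j l * H j l)"
    by (rule sum.swap)
  also have "\<dots> = (\<Sum>l<L. \<Sum>j\<in>S. - (\<Sum>m\<in>?T. U j l * ?p m j * H m l))"
    by (intro sum.cong refl) (simp add: mat_kernel_rows_eq[OF assms] sum_distrib_left mult.assoc)
  also have "\<dots> = - (\<Sum>l<L. \<Sum>m\<in>?T. \<Sum>j\<in>S. U j l * ?p m j * H m l)"
    by (simp add: sum_negf sum.swap[of _ ?T S])
  also have "\<dots> = - (\<Sum>m\<in>?T. \<Sum>l<L. certificate_column A n S U m l * H m l)"
    by (simp add: certificate_column_def sum_distrib_right sum.swap[of _ ?T "{..<L}"])
  finally show ?thesis .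
qed

lemma norm21_add_mat_kernel_ge:
  assumes "full_col_rank_on A n S" "S \<subseteq> {..<N}" "H \<in> mat_kernel A n N L"
    and X_zero: "\<And>j l. j \<notin> S \<Longrightarrow> X j l = 0"
    and U_le: "\<And>j. j \<in> S \<Longrightarrow> norm2S {..<L} (U j) \<le> 1"
    and U_X: "\<And>j. j \<in> S \<Longrightarrow> (\<Sum>l<L. U j l * X j l) = complex_of_real (norm2S {..<L} (X j))"
  shows "norm21 N L X
      + (\<Sum>m\<in>{..<N} - S. (1 - norm2S {..<L} (certificate_column A n S U m)) * norm2S {..<L} (H m))
    \<le> norm21 N L (\<lambda>j l. X j l + H j l)"
proof -
  let ?T = "{..<N} - S" and ?norm = "norm2S {..<L}" and ?V = "certificate_column A n S U"
  have split: "norm21 N L Z = (\<Sum>j\<in>S. ?norm (Z j)) + (\<Sum>m\<in>?T. ?norm (Z m))" for Z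
    unfolding norm21_eq_sum_norm2S using \<open>S \<subseteq> {..<N}\<close> by (subst sum.subset_diff[of S]) auto
  have norm_X: "norm21 N L X = (\<Sum>j\<in>S. ?norm (X j))"
    unfolding split[of X] by (simp add: X_zero norm2S_def)
  have norm_XH: "norm21 N L (\<lambda>j l. X j l + H j l)
      = (\<Sum>j\<in>S. ?norm (\<lambda>l. X j l + H j l)) + (\<Sum>m\<in>?T. ?norm (H m))"
    unfolding split[of "\<lambda>j l. X j l + H j l"] by (simp add: X_zero)
  have "Re (\<Sum>m\<in>?T. \<Sum>l<L. ?V m l * H m l) \<le> cmod (\<Sum>m\<in>?T. \<Sum>l<L. ?V m l * H m l)"
    by (rule complex_Re_le_cmod)
  also have "\<dots> \<le> (\<Sum>m\<in>?T. ?norm (?V m) * ?norm (H m))"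
    by (rule order_trans[OF norm_sum sum_mono]) (rule cmod_sum_mult_le_norm2S)
  finally have off_support:
    "- (\<Sum>m\<in>?T. ?norm (?V m) * ?norm (H m)) \<le> Re (\<Sum>j\<in>S. \<Sum>l<L. U j l * H j l)"
    by (simp add: sum_mult_mat_kernel[OF assms(1-3)])
  have on_support: "(\<Sum>j\<in>S. ?norm (X j)) + Re (\<Sum>j\<in>S. \<Sum>l<L. U j l * H j l)
      \<le> (\<Sum>j\<in>S. ?norm (\<lambda>l. X j l + H j l))"
    unfolding Re_sum[of _ S] sum.distrib[symmetric]
    by (intro sum_mono norm2S_add_ge_subgradient U_le U_X)
  have "(\<Sum>m\<in>?T. (1 - ?norm (?V m)) * ?norm (H m))
      = (\<Sum>m\<in>?T. ?norm (H m)) - (\<Sum>m\<in>?T. ?norm (?V m) * ?norm (H m))"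
    by (simp add: left_diff_distrib sum_subtractf)
  then show ?thesis
    using off_support on_support unfolding norm_X norm_XH by linarith
qed

lemma unique_l21_solution_dual_certificate:
  assumes rank: "full_col_rank_on A n S" and sub: "S \<subseteq> {..<N}"
    and X_zero: "\<And>j l. j \<notin> S \<Longrightarrow> X j l = 0"
    and U_le: "\<And>j. j \<in> S \<Longrightarrow> norm2S {..<L} (U j) \<le> 1"
    and U_X: "\<And>j. j \<in> S \<Longrightarrow> (\<Sum>l<L. U j l * X j l) = complex_of_real (norm2S {..<L} (X j))"
    and dual: "\<And>m. m \<in> {..<N} - S \<Longrightarrow> norm2S {..<L} (certificate_column A n S U m) < 1"
  shows "unique_l21_solution A n N L X"
  unfolding unique_l21_solution_iff
proof (intro ballI impI)
  let ?T = "{..<N} - S" and ?norm = "norm2S {..<L}"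
  fix H assume H: "H \<in> mat_kernel A n N L" and "norm21 N L H \<noteq> 0"
  have "\<exists>m\<in>?T. \<exists>l<L. H m l \<noteq> 0"
  proof (rule ccontr)
    assume "\<not> ?thesis"
    then have zero_T: "H m l = 0" if "m \<in> ?T" "l < L" for m l using that by blast
    then have "H j l = 0" if "j \<in> S" "l < L" for j l
      using mat_kernel_rows_eq[OF rank sub H that] that by simp
    with zero_T have "norm21 N L H = 0" unfolding norm21_eq_0_iff by blast
    with \<open>norm21 N L H \<noteq> 0\<close> show False by simp
  qed
  then obtain m where "m \<in> ?T" "?norm (H m) \<noteq> 0"
    by (auto simp: norm2S_eq_L2_set L2_set_eq_0_iff)
  then have "0 < (\<Sum>m\<in>?T. (1 - ?norm (certificate_column A n S U m)) * ?norm (H m))"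
    using dual norm2S_nonneg[of "{..<L}"]
    by (intro sum_pos2[of _ m]) (auto simp: less_le intro!: mult_nonneg_nonneg)
  then show "norm21 N L X < norm21 N L (\<lambda>j l. X j l + H j l)"
    using norm21_add_mat_kernel_ge[where X = X and U = U, OF rank sub H X_zero U_le U_X] by linarith
qed

section \<open>Measurability of the recovery event\<close>

lemma closed_Bex_compact:
  fixes K :: "'a::topological_space set" and C :: "('a \<times> 'b::topological_space) set"
  assumes "compact K" "closed C"
  shows "closed {y. \<exists>x\<in>K. (x, y) \<in> C}"
proof -
  have "closed_map (prod_topology (top_of_set K) (euclidean :: 'b topology)) euclidean snd"
    using assms(1) by (intro closed_map_snd) (simp add: compact_space_subtopology)
  moreover have "closedin (prod_topology (top_of_set K) (euclidean :: 'b topology)) (C \<inter> K \<times> UNIV)"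
  proof -
    have "prod_topology (top_of_set K) (euclidean :: 'b topology) = top_of_set (K \<times> UNIV)"
      by (simp add: prod_topology_subtopology(1))
    then show ?thesis using assms(2) by (simp add: closedin_closed_Int Int_commute[of C])
  qed
  ultimately have "closedin euclidean (snd ` (C \<inter> K \<times> UNIV))" by (auto simp: closed_map_def)
  moreover have "snd ` (C \<inter> K \<times> UNIV) = {y. \<exists>x\<in>K. (x, y) \<in> C}" by force
  ultimately show ?thesis by simp
qed

lemma compact_PiE_UNIV:
  fixes C :: "'i \<Rightarrow> 'b::topological_space set"
  assumes "\<And>i. compact (C i)"
  shows "compact (PiE UNIV C)"
proof -
  have "compactin (product_topology (\<lambda>i. euclidean) UNIV) (PiE UNIV C)"
    using assms by (simp add: compactin_PiE)
  then show ?thesis by (simp add: euclidean_product_topology)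
qed

lemma continuous_on_norm21:
  assumes "\<And>j l. continuous_on T (\<lambda>x. f x j l)"
  shows "continuous_on T (\<lambda>x. norm21 N L (f x))"
  unfolding norm21_def by (intro continuous_intros assms)

lemma cmod_le_norm21:
  assumes "j < N" "l < L"
  shows "cmod (H j l) \<le> norm21 N L H"
proof -
  have "cmod (H j l) \<le> norm2S {..<L} (H j)"
    unfolding norm2S_eq_L2_set using assms by (intro member_le_L2_set) auto
  also have "\<dots> \<le> norm21 N L H"
    unfolding norm21_eq_sum_norm2S using assms by (intro member_le_sum norm2S_nonneg) auto
  finally show ?thesis .
qed

text \<open>The nonzero kernel elements supported on \<open>{..<N} \<times> {..<L}\<close> are the union of these compact sets.\<close>
definition kernel_shell ::
  "(nat \<Rightarrow> nat \<Rightarrow> complex) \<Rightarrow> nat \<Rightarrow> nat \<Rightarrow> nat \<Rightarrow> nat \<Rightarrow> (nat \<times> nat \<Rightarrow> complex) set" where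
  "kernel_shell A n N L m =
     PiE UNIV (\<lambda>p. cball 0 (if p \<in> {..<N} \<times> {..<L} then real m else 0)) \<inter>
     {H. curry H \<in> mat_kernel A n N L \<and> 1 / real (Suc m) \<le> norm21 N L (curry H)}"

lemma compact_kernel_shell: "compact (kernel_shell A n N L m)"
proof -
  have "closed {H. curry H \<in> mat_kernel A n N L \<and> 1 / real (Suc m) \<le> norm21 N L (curry H)}"
    unfolding mat_kernel_def mat_mult_def mem_Collect_eq curry_def
    by (intro closed_Collect_conj closed_Collect_all closed_Collect_imp closed_Collect_eq closed_Collect_le
        open_Collect_const continuous_on_norm21 continuous_intros continuous_on_product_coordinates)
  then show ?thesis
    unfolding kernel_shell_def by (intro compact_Int_closed compact_PiE_UNIV) simp_all
qed

lemma kernel_shell_exhausts: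
  assumes "H \<in> mat_kernel A n N L" "norm21 N L H \<noteq> 0"
  obtains G m where "G \<in> kernel_shell A n N L m" "\<forall>j<N. \<forall>l<L. G (j, l) = H j l"
proof -
  define G where "G = (\<lambda>(j, l). if j < N \<and> l < L then H j l else 0)"
  have G_eq: "G (j, l) = H j l" if "j < N" "l < L" for j l using that by (simp add: G_def)
  have norm_G: "norm21 N L (curry G) = norm21 N L H"
    by (intro norm21_cong) (simp add: G_eq)
  have "0 < norm21 N L H"
    using assms(2) by (simp add: less_le norm21_eq_sum_norm2S sum_nonneg norm2S_nonneg)
  obtain m1 where "norm21 N L H \<le> real m1" using real_arch_simple by blast
  moreover obtain m2 where "1 / real (Suc m2) < norm21 N L H"
    using nat_approx_posE[OF \<open>0 < norm21 N L H\<close>] by blast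
  moreover have "1 / real (Suc (max m1 m2)) \<le> 1 / real (Suc m2)"
    by (intro divide_left_mono) auto
  moreover define m where "m = max m1 m2"
  ultimately have m: "norm21 N L H \<le> real m" "1 / real (Suc m) \<le> norm21 N L H"
    by auto
  have "G p \<in> cball 0 (if p \<in> {..<N} \<times> {..<L} then real m else 0)" for p
    using cmod_le_norm21[of "fst p" N "snd p" L H] m(1) by (cases p) (auto simp: G_def)
  moreover have "curry G \<in> mat_kernel A n N L"
    using assms(1) by (simp add: mat_kernel_def mat_mult_def G_eq)
  ultimately have "G \<in> kernel_shell A n N L m"
    using m(2) by (simp add: kernel_shell_def norm_G PiE_UNIV_domain)
  with G_eq show ?thesis by (intro that) auto
qed

lemma borel_unique_l21_solution:
  "{X :: nat \<times> nat \<Rightarrow> complex. unique_l21_solution A n N L (curry X)} \<in> sets borel"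
proof -
  define C where "C = {(H, X). norm21 N L (\<lambda>j l. X (j, l) + H (j, l)) \<le> norm21 N L (curry X)}"
  have "continuous_on UNIV (\<lambda>x :: (nat \<times> nat \<Rightarrow> complex) \<times> (nat \<times> nat \<Rightarrow> complex). fst x p)"
    and "continuous_on UNIV (\<lambda>x :: (nat \<times> nat \<Rightarrow> complex) \<times> (nat \<times> nat \<Rightarrow> complex). snd x p)" for p
    by (rule continuous_on_product_then_coordinatewise, intro continuous_intros)+
  then have "closed C"
    unfolding C_def case_prod_beta' curry_def
    by (intro closed_Collect_le continuous_on_norm21 continuous_on_add)
  have "{X. \<not> unique_l21_solution A n N L (curry X)}
      = (\<Union>m. {X. \<exists>H\<in>kernel_shell A n N L m. (H, X) \<in> C})" (is "?bad = ?proj")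
  proof (intro equalityI subsetI)
    fix X assume "X \<in> ?bad"
    then obtain H where H: "H \<in> mat_kernel A n N L" "norm21 N L H \<noteq> 0"
      and le: "norm21 N L (\<lambda>j l. X (j, l) + H j l) \<le> norm21 N L (curry X)"
      by (auto simp: unique_l21_solution_iff not_less)
    obtain G m where G: "G \<in> kernel_shell A n N L m" and G_eq: "\<forall>j<N. \<forall>l<L. G (j, l) = H j l"
      by (rule kernel_shell_exhausts[OF H])
    have "norm21 N L (\<lambda>j l. X (j, l) + G (j, l)) = norm21 N L (\<lambda>j l. X (j, l) + H j l)"
      by (intro norm21_cong) (simp add: G_eq)
    then have "(G, X) \<in> C" using le by (simp add: C_def)
    then show "X \<in> ?proj" using G by blast
  next
    fix X assume "X \<in> ?proj"
    then obtain m H where "H \<in> kernel_shell A n N L m" "(H, X) \<in> C" by blast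
    then have "curry H \<in> mat_kernel A n N L" "norm21 N L (curry H) \<noteq> 0"
      and "norm21 N L (\<lambda>j l. curry X j l + curry H j l) \<le> norm21 N L (curry X)"
      by (auto simp: kernel_shell_def C_def)
    then show "X \<in> ?bad" unfolding mem_Collect_eq unique_l21_solution_iff not_less[symmetric] by blast
  qed
  then have "?bad \<in> sets borel"
    using closed_Bex_compact[OF compact_kernel_shell \<open>closed C\<close>] by auto
  from borel_comp[OF this] show ?thesis by (simp add: Collect_neg_eq)
qed

lemma sets_unique_l21_solution:
  "{\<Phi> \<in> space (gauss_entries S L). unique_l21_solution A n N L (X_of S \<sigma> \<Phi>)} \<in> sets (gauss_entries S L)"
proof -
  have "(\<lambda>\<Phi>. \<Phi> (j, l)) \<in> borel_measurable (gauss_entries S L)" for j l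
  proof (cases "(j, l) \<in> S \<times> {..<L}")
    case True
    then show ?thesis unfolding gauss_entries_def by measurable
  next
    case False
    then have "\<Phi> (j, l) = undefined" if "\<Phi> \<in> space (gauss_entries S L)" for \<Phi>
      using that unfolding gauss_entries_def space_PiM by (rule PiE_arb[rotated])
    then show ?thesis by (subst measurable_cong[where g = "\<lambda>_. undefined"]) simp_all
  qed
  then have "(\<lambda>\<Phi>. case_prod (X_of S \<sigma> \<Phi>) (j, l)) \<in> borel_measurable (gauss_entries S L)" for j l
    by (simp add: X_of_def)
  then have "(\<lambda>\<Phi>. case_prod (X_of S \<sigma> \<Phi>)) \<in> borel_measurable (gauss_entries S L)"
    by (intro measurable_coordinatewise_then_product) auto
  from measurable_sets[OF this borel_unique_l21_solution]
  show ?thesis by (simp add: vimage_def Int_def conj_commute)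
qed

section \<open>Product measures\<close>

lemma density_PiM:
  fixes f :: "'i \<Rightarrow> 'a \<Rightarrow> ennreal"
  assumes "finite I" and "\<And>i. sigma_finite_measure (M i)"
    and [measurable]: "\<And>i. f i \<in> borel_measurable (M i)"
    and "\<And>i. sigma_finite_measure (density (M i) (f i))"
  shows "density (PiM I M) (\<lambda>x. \<Prod>i\<in>I. f i (x i)) = PiM I (\<lambda>i. density (M i) (f i))"
proof -
  interpret M: product_sigma_finite M
    using assms(2) by (simp add: product_sigma_finite_def)
  interpret density: product_sigma_finite "\<lambda>i. density (M i) (f i)"
    using assms(4) by (simp add: product_sigma_finite_def)
  show ?thesis
  proof (rule density.PiM_eqI[OF \<open>finite I\<close>])
    show "sets (density (PiM I M) (\<lambda>x. \<Prod>i\<in>I. f i (x i))) = sets (PiM I (\<lambda>i. density (M i) (f i)))"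
      by (simp cong: sets_PiM_cong)
    fix A assume "\<And>i. i \<in> I \<Longrightarrow> A i \<in> sets (density (M i) (f i))"
    then have [measurable]: "\<And>i. i \<in> I \<Longrightarrow> A i \<in> sets (M i)" by simp
    have "emeasure (density (PiM I M) (\<lambda>x. \<Prod>i\<in>I. f i (x i))) (PiE I A)
        = (\<integral>\<^sup>+x. (\<Prod>i\<in>I. f i (x i)) * indicator (PiE I A) x \<partial>PiM I M)"
      using \<open>finite I\<close> by (intro emeasure_density) (auto intro!: sets_PiM_I_finite)
    also have "\<dots> = (\<integral>\<^sup>+x. (\<Prod>i\<in>I. f i (x i) * indicator (A i) (x i)) \<partial>PiM I M)"
      using \<open>finite I\<close>
      by (intro nn_integral_cong)
        (auto simp: prod.distrib indicator_def space_PiM PiE_iff)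
    also have "\<dots> = (\<Prod>i\<in>I. \<integral>\<^sup>+x. f i x * indicator (A i) x \<partial>M i)"
      using \<open>finite I\<close> by (intro M.product_nn_integral_prod) auto
    also have "\<dots> = (\<Prod>i\<in>I. emeasure (density (M i) (f i)) (A i))"
      by (intro prod.cong refl) (simp add: emeasure_density)
    finally show "emeasure (density (PiM I M) (\<lambda>x. \<Prod>i\<in>I. f i (x i))) (PiE I A)
        = (\<Prod>i\<in>I. emeasure (density (M i) (f i)) (A i))" .
  qed
qed

lemma indep_vars_PiM_coordinates:
  assumes "\<And>i. i \<in> I \<Longrightarrow> prob_space (M i)"
  shows "prob_space.indep_vars (PiM I M) M (\<lambda>i x. x i) I"
proof -
  interpret prob_space "PiM I M" using assms by (rule prob_space_PiM)
  show ?thesis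
  proof (cases "I = {}")
    case True
    show ?thesis unfolding indep_vars_def indep_sets_def by (simp add: True)
  next
    case False
    have "distr (PiM I M) (PiM I M) (\<lambda>x. \<lambda>i\<in>I. x i) = distr (PiM I M) (PiM I M) (\<lambda>x. x)"
      by (intro distr_cong) (auto simp: space_PiM)
    also have "\<dots> = PiM I (\<lambda>i. distr (PiM I M) (M i) (\<lambda>x. x i))"
      by (simp add: distr_PiM_component assms cong: PiM_cong)
    finally show ?thesis
      using False by (subst indep_vars_iff_distr_eq_PiM') auto
  qed
qed

lemma nn_integral_PiM_Times:
  fixes f :: "'j \<Rightarrow> ('i \<Rightarrow> 'a) \<Rightarrow> ennreal"
  assumes "finite S" and M: "prob_space M"
    and [measurable]: "\<And>j. f j \<in> borel_measurable (PiM T (\<lambda>_. M))"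
  shows "(\<integral>\<^sup>+x. (\<Prod>j\<in>S. f j (\<lambda>l\<in>T. x (j, l))) \<partial>PiM (S \<times> T) (\<lambda>_. M))
       = (\<Prod>j\<in>S. \<integral>\<^sup>+x. f j x \<partial>PiM T (\<lambda>_. M))"
proof -
  let ?P = "PiM (S \<times> T) (\<lambda>_. M)"
  interpret prob_space ?P using M by (intro prob_space_PiM)
  define row where "row = (\<lambda>j (x :: 'j \<times> 'i \<Rightarrow> 'a). \<lambda>l\<in>T. x (j, l))"
  have row_restrict: "row j x = (\<lambda>l\<in>T. restrict x ({j} \<times> T) (j, l))" for j x
    by (simp add: row_def fun_eq_iff)
  have meas: "(\<lambda>y. f j (\<lambda>l\<in>T. y (j, l))) \<in> borel_measurable (PiM ({j} \<times> T) (\<lambda>_. M))" for j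
    by measurable
  have "indep_vars (\<lambda>j. PiM ({j} \<times> T) (\<lambda>_. M)) (\<lambda>j x. restrict x ({j} \<times> T)) S"
    using M
    by (intro indep_vars_restrict[where X = "\<lambda>i x. x i" and M' = "\<lambda>_. M" and I = "S \<times> T", simplified]
        indep_vars_PiM_coordinates) (auto simp: disjoint_family_on_def)
  then have "indep_vars (\<lambda>_. borel) (\<lambda>j x. f j (row j x)) S"
    unfolding row_restrict by (rule indep_vars_compose2) (rule meas)
  then have "(\<integral>\<^sup>+x. (\<Prod>j\<in>S. f j (row j x)) \<partial>?P) = (\<Prod>j\<in>S. \<integral>\<^sup>+x. f j (row j x) \<partial>?P)"
    by (intro indep_vars_nn_integral[OF \<open>finite S\<close>]) auto
  also have "\<dots> = (\<Prod>j\<in>S. \<integral>\<^sup>+x. f j x \<partial>PiM T (\<lambda>_. M))"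
  proof (rule prod.cong[OF refl])
    fix j assume "j \<in> S"
    then have "distr ?P (PiM T (\<lambda>_. M)) (row j) = PiM T (\<lambda>_. M)"
      unfolding row_def
      by (intro distr_PiM_reindex[of "S \<times> T" "\<lambda>_. M" "\<lambda>l. (j, l)" T] M) (auto intro: inj_onI)
    moreover have "row j \<in> ?P \<rightarrow>\<^sub>M PiM T (\<lambda>_. M)"
      unfolding row_def using \<open>j \<in> S\<close> by (intro measurable_restrict measurable_component_singleton) auto
    ultimately show "(\<integral>\<^sup>+x. f j (row j x) \<partial>?P) = (\<integral>\<^sup>+x. f j x \<partial>PiM T (\<lambda>_. M))"
      using nn_integral_distr[of "row j" ?P "PiM T (\<lambda>_. M)" "f j"] by simp
  qed
  finally show ?thesis by (simp only: row_def)
qed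

section \<open>Gaussian vectors\<close>

abbreviation std_normal :: "real measure" where
  "std_normal \<equiv> density lborel std_normal_density"

lemma prob_space_std_normal: "prob_space std_normal"
  by (rule prob_space_normal_density) simp

abbreviation std_normal_vec :: "'i set \<Rightarrow> ('i \<Rightarrow> real) measure" where
  "std_normal_vec I \<equiv> PiM I (\<lambda>_. std_normal)"

lemma prob_space_std_normal_vec: "prob_space (std_normal_vec I)"
  by (intro prob_space_PiM prob_space_std_normal)

lemma sets_std_normal_vec [measurable_cong]: "sets (std_normal_vec I) = sets (PiM I (\<lambda>_. borel))"
  by (rule sets_PiM_cong) auto

lemma nn_integral_exp_square_std_normal:
  assumes "\<theta> < 1 / 2"
  shows "(\<integral>\<^sup>+x. ennreal (exp (\<theta> * x\<^sup>2)) \<partial>std_normal) = ennreal (1 / sqrt (1 - 2 * \<theta>))"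
proof -
  define s where "s = 1 / sqrt (1 - 2 * \<theta>)"
  have "s > 0" using assms by (simp add: s_def)
  have s2: "1 / s\<^sup>2 = 1 - 2 * \<theta>" using assms by (simp add: s_def power_divide)
  have "std_normal_density x * exp (\<theta> * x\<^sup>2) = s * normal_density 0 s x" for x
  proof -
    have "- x\<^sup>2 / 2 + \<theta> * x\<^sup>2 = - (1 - 2 * \<theta>) * x\<^sup>2 / 2" by (simp add: field_simps)
    also have "\<dots> = - x\<^sup>2 / (2 * s\<^sup>2)" unfolding s2[symmetric] by simp
    finally show ?thesis
      using \<open>s > 0\<close> by (simp add: normal_density_def exp_add[symmetric] real_sqrt_mult)
  qed
  then have "(\<integral>\<^sup>+x. ennreal (exp (\<theta> * x\<^sup>2)) \<partial>std_normal)
      = (\<integral>\<^sup>+x. ennreal s * ennreal (normal_density 0 s x) \<partial>lborel)"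
    using \<open>s > 0\<close> by (subst nn_integral_density) (auto simp: ennreal_mult[symmetric])
  also have "\<dots> = ennreal s"
    using \<open>s > 0\<close> by (subst nn_integral_cmult) (auto simp: nn_integral_eq_integral)
  finally show ?thesis by (simp add: s_def)
qed

lemma distr_std_normal_mult:
  assumes "\<beta> > 0"
  shows "distr std_normal borel (\<lambda>x. \<beta> * x)
       = density std_normal (\<lambda>x. ennreal (exp (- (1 / \<beta>\<^sup>2 - 1) / 2 * x\<^sup>2) / \<beta>))"
proof -
  interpret prob_space std_normal by (rule prob_space_std_normal)
  have "distributed std_normal lborel (\<lambda>x. x) std_normal_density"
    by (simp add: distributed_def distr_id2)
  then have "distributed std_normal lborel (\<lambda>x. 0 + \<beta> * x) (normal_density (0 + \<beta> * 0) (\<bar>\<beta>\<bar> * 1))"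
    using assms by (intro normal_density_affine) auto
  then have "distr std_normal lborel (\<lambda>x. \<beta> * x) = density lborel (normal_density 0 \<beta>)"
    using assms by (simp add: distributed_distr_eq_density)
  moreover have "normal_density 0 \<beta> x
      = std_normal_density x * (exp (- (1 / \<beta>\<^sup>2 - 1) / 2 * x\<^sup>2) / \<beta>)" for x
    using assms by (simp add: normal_density_def exp_add[symmetric] real_sqrt_mult field_simps)
  ultimately show ?thesis
    using assms by (simp add: density_density_eq ennreal_mult[symmetric] cong: distr_cong)
qed

lemma distributed_std_normal_vec_linear:
  assumes "finite I" "(\<Sum>i\<in>I. (z i)\<^sup>2) \<noteq> 0"
  shows "distributed (std_normal_vec I) lborel (\<lambda>x. \<Sum>i\<in>I. z i * x i)
      (normal_density 0 (sqrt (\<Sum>i\<in>I. (z i)\<^sup>2)))"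
proof -
  let ?G = "std_normal_vec I"
  interpret prob_space ?G by (rule prob_space_std_normal_vec)
  define J where "J = {i \<in> I. z i \<noteq> 0}"
  have J: "finite J" "J \<subseteq> I" using \<open>finite I\<close> by (auto simp: J_def)
  have sum_J: "(\<Sum>i\<in>J. g i) = (\<Sum>i\<in>I. g i)" if "\<And>i. z i = 0 \<Longrightarrow> g i = 0" for g :: "_ \<Rightarrow> real"
    using \<open>finite I\<close> that by (intro sum.mono_neutral_left) (auto simp: J_def)
  have "indep_vars (\<lambda>_. std_normal) (\<lambda>i x. x i) I"
    by (intro indep_vars_PiM_coordinates prob_space_std_normal)
  then have "indep_vars (\<lambda>_. borel) (\<lambda>i x. z i * x i) J"
    by (intro indep_vars_compose2[OF indep_vars_subset[OF _ J(2)]]) auto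
  moreover have "distributed ?G lborel (\<lambda>x. z i * x i) (normal_density 0 \<bar>z i\<bar>)" if "i \<in> J" for i
  proof -
    have "i \<in> I" "z i \<noteq> 0" using that by (auto simp: J_def)
    have "distr ?G lborel (\<lambda>x. x i) = distr ?G std_normal (\<lambda>x. x i)"
      by (intro distr_cong) auto
    also have "\<dots> = std_normal"
      using \<open>i \<in> I\<close> by (intro distr_PiM_component prob_space_std_normal)
    finally have "distributed ?G lborel (\<lambda>x. x i) std_normal_density"
      using \<open>i \<in> I\<close> by (simp add: distributed_def)
    from normal_density_affine[OF this, of "z i" 0] \<open>z i \<noteq> 0\<close> show ?thesis by simp
  qed
  moreover have "J \<noteq> {}"
    using assms(2) sum_J[of "\<lambda>i. (z i)\<^sup>2"] by auto
  ultimately have "distributed ?G lborel (\<lambda>x. \<Sum>i\<in>J. z i * x i)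
      (normal_density (\<Sum>i\<in>J. 0) (sqrt (\<Sum>i\<in>J. \<bar>z i\<bar>\<^sup>2)))"
    using J(1) by (intro sum_indep_normal) (auto simp: J_def)
  then show ?thesis
    by (simp add: sum_J)
qed

lemma nn_integral_std_normal_vec_mult:
  assumes "finite I" "\<beta> > 0" and f: "f \<in> borel_measurable (PiM I (\<lambda>_. borel))"
  shows "(\<integral>\<^sup>+x. f (\<lambda>i\<in>I. \<beta> * x i) \<partial>std_normal_vec I)
       = (\<integral>\<^sup>+x. ennreal (exp (- (1 / \<beta>\<^sup>2 - 1) / 2 * (\<Sum>i\<in>I. (x i)\<^sup>2)) / \<beta> ^ card I) * f x
           \<partial>std_normal_vec I)"
proof -
  let ?G = "std_normal_vec I"
  define w where "w = (\<lambda>x::real. exp (- (1 / \<beta>\<^sup>2 - 1) / 2 * x\<^sup>2) / \<beta>)"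
  have [measurable]: "w \<in> borel_measurable borel" unfolding w_def by measurable
  have scaled: "distr std_normal std_normal (\<lambda>x. \<beta> * x) = density std_normal w"
    using distr_std_normal_mult[OF \<open>\<beta> > 0\<close>] by (simp add: w_def cong: distr_cong)
  have prob_scaled: "prob_space (density std_normal w)"
    unfolding scaled[symmetric] by (intro prob_space.prob_space_distr prob_space_std_normal) simp
  have w_prod: "(\<Prod>i\<in>I. w (x i)) = exp (- (1 / \<beta>\<^sup>2 - 1) / 2 * (\<Sum>i\<in>I. (x i)\<^sup>2)) / \<beta> ^ card I" for x
    by (simp add: w_def prod_dividef exp_sum[OF \<open>finite I\<close>] sum_distrib_left)
  have "distr ?G ?G (compose I (\<lambda>x. \<beta> * x)) = PiM I (\<lambda>_. density std_normal w)"
    unfolding scaled[symmetric]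
    using \<open>finite I\<close> by (intro distr_PiM_finite_prob_space' prob_space_std_normal) auto
  also have "\<dots> = density ?G (\<lambda>x. \<Prod>i\<in>I. ennreal (w (x i)))"
    using \<open>finite I\<close> prob_scaled
    by (intro density_PiM[symmetric]) (auto intro: prob_space_imp_sigma_finite prob_space_std_normal)
  also have "\<dots> = density ?G (\<lambda>x. ennreal (exp (- (1 / \<beta>\<^sup>2 - 1) / 2 * (\<Sum>i\<in>I. (x i)\<^sup>2)) / \<beta> ^ card I))"
    unfolding w_prod[symmetric] using \<open>\<beta> > 0\<close> by (simp add: prod_ennreal w_def)
  finally have "(\<integral>\<^sup>+x. f x \<partial>distr ?G ?G (compose I (\<lambda>x. \<beta> * x)))
      = (\<integral>\<^sup>+x. f x \<partial>density ?G (\<lambda>x. ennreal (exp (- (1 / \<beta>\<^sup>2 - 1) / 2 * (\<Sum>i\<in>I. (x i)\<^sup>2)) / \<beta> ^ card I)))"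
    by simp
  moreover have "compose I (\<lambda>x. \<beta> * x) \<in> ?G \<rightarrow>\<^sub>M ?G"
    unfolding compose_def by measurable
  ultimately show ?thesis
    using f by (simp add: nn_integral_distr nn_integral_density compose_def)
qed

section \<open>Directions of Gaussian vectors\<close>

text \<open>The zero vector is its own normalization because \<open>0 / 0 = 0\<close>.\<close>
definition normalized :: "'i set \<Rightarrow> ('i \<Rightarrow> real) \<Rightarrow> 'i \<Rightarrow> real" where
  "normalized I x i = x i / L2_set x I"

lemma power2_L2_set: "(L2_set x I)\<^sup>2 = (\<Sum>i\<in>I. (x i)\<^sup>2)"
  by (simp add: L2_set_def sum_nonneg)

lemma sum_mult_normalized: "(\<Sum>i\<in>I. z i * normalized I x i) = (\<Sum>i\<in>I. z i * x i) / L2_set x I"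
  by (simp add: normalized_def sum_divide_distrib)

lemma sum_power2_normalized: "(\<Sum>i\<in>I. (normalized I x i)\<^sup>2) = (if L2_set x I = 0 then 0 else 1)"
proof -
  have "(\<Sum>i\<in>I. (normalized I x i)\<^sup>2) = (\<Sum>i\<in>I. (x i)\<^sup>2) / (L2_set x I)\<^sup>2"
    by (simp add: normalized_def power_divide sum_divide_distrib)
  then show ?thesis by (simp add: power2_L2_set[symmetric])
qed

lemma sum_mult_normalized_scale:
  assumes "\<beta> > 0"
  shows "(\<Sum>i\<in>I. z i * normalized I (\<lambda>i\<in>I. \<beta> * x i) i) = (\<Sum>i\<in>I. z i * normalized I x i)"
proof -
  have "L2_set (\<lambda>i\<in>I. \<beta> * x i) I = \<beta> * L2_set x I"
    using assms by (subst L2_set_right_distrib) (auto intro: L2_set_cong)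
  then show ?thesis
    using assms by (intro sum.cong) (auto simp: normalized_def)
qed

lemma power2_sum_mult_normalized_le:
  assumes "(\<Sum>i\<in>I. (z i)\<^sup>2) = 1"
  shows "(\<Sum>i\<in>I. z i * normalized I x i)\<^sup>2 \<le> 1"
  using Cauchy_Schwarz_ineq_sum[of z "normalized I x" I] assms
  by (simp add: sum_power2_normalized split: if_splits)

lemma power2_sum_mult_normalized_mult:
  assumes "finite I"
  shows "(\<Sum>i\<in>I. z i * normalized I x i)\<^sup>2 * (\<Sum>i\<in>I. (x i)\<^sup>2) = (\<Sum>i\<in>I. z i * x i)\<^sup>2"
proof (cases "L2_set x I = 0")
  case True
  then show ?thesis using assms by (simp add: L2_set_eq_0_iff)
next
  case False
  then show ?thesis by (simp add: sum_mult_normalized power_divide power2_L2_set[symmetric])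
qed

lemma measurable_sum_mult_normalized [measurable]:
  "(\<lambda>x. \<Sum>i\<in>I. z i * normalized I x i) \<in> borel_measurable (PiM I (\<lambda>_. borel))"
  unfolding sum_mult_normalized L2_set_def by measurable

lemma of_nat_mult_le_if_scaled_le:
  fixes p r :: real
  assumes "\<And>\<beta>. 0 < \<beta> \<Longrightarrow> \<beta> < 1 \<Longrightarrow> p \<le> \<beta> ^ n * p + (1 / \<beta>\<^sup>2 - 1) / 2 * r"
  shows "of_nat n * p \<le> r"
proof -
  have le: "2 * \<beta>\<^sup>2 * (\<Sum>i<n. \<beta> ^ i) * p \<le> (1 + \<beta>) * r" if \<beta>: "0 < \<beta>" "\<beta> < 1" for \<beta>
  proof -
    have "(1 - \<beta>) * (2 * \<beta>\<^sup>2 * (\<Sum>i<n. \<beta> ^ i) * p) = 2 * \<beta>\<^sup>2 * ((1 - \<beta> ^ n) * p)"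
      by (simp add: one_diff_power_eq)
    also have "\<dots> \<le> 2 * \<beta>\<^sup>2 * ((1 / \<beta>\<^sup>2 - 1) / 2 * r)"
    proof (rule mult_left_mono)
      have "(1 - \<beta> ^ n) * p = p - \<beta> ^ n * p" by (simp add: left_diff_distrib)
      then show "(1 - \<beta> ^ n) * p \<le> (1 / \<beta>\<^sup>2 - 1) / 2 * r"
        using assms[OF \<beta>] by linarith
    qed simp
    also have "\<dots> = (1 - \<beta>) * ((1 + \<beta>) * r)"
      using \<beta> by (simp add: field_simps power2_eq_square)
    finally show ?thesis using \<beta> by simp
  qed
  have "2 * 1\<^sup>2 * (\<Sum>i<n. 1 ^ i) * p \<le> (1 + 1) * r"
  proof (rule tendsto_le)
    show "((\<lambda>\<beta>. (1 + \<beta>) * r) \<longlongrightarrow> (1 + 1) * r) (at_left 1)"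
      and "((\<lambda>\<beta>. 2 * \<beta>\<^sup>2 * (\<Sum>i<n. \<beta> ^ i) * p) \<longlongrightarrow> 2 * 1\<^sup>2 * (\<Sum>i<n. 1 ^ i) * p) (at_left 1)"
      by (intro tendsto_intros)+
    show "\<forall>\<^sub>F \<beta> in at_left 1. 2 * \<beta>\<^sup>2 * (\<Sum>i<n. \<beta> ^ i) * p \<le> (1 + \<beta>) * r"
      using eventually_at_left_real[OF zero_less_one] by (rule eventually_mono) (auto intro: le)
  qed simp
  then show ?thesis by simp
qed

lemma nn_integral_scale_invariant_le:
  fixes q :: "('i \<Rightarrow> real) \<Rightarrow> real"
  assumes "finite I" and [measurable]: "q \<in> borel_measurable (PiM I (\<lambda>_. borel))"
    and q_nonneg: "\<And>x. 0 \<le> q x"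
    and q_scale: "\<And>x. q (\<lambda>i\<in>I. \<beta> * x i) = q x"
    and \<beta>: "0 < \<beta>" "\<beta> < 1"
  shows "(\<integral>\<^sup>+x. ennreal (q x) \<partial>std_normal_vec I)
      \<le> ennreal (\<beta> ^ card I) * (\<integral>\<^sup>+x. ennreal (q x) \<partial>std_normal_vec I)
        + ennreal ((1 / \<beta>\<^sup>2 - 1) / 2) * (\<integral>\<^sup>+x. ennreal (q x * (\<Sum>i\<in>I. (x i)\<^sup>2)) \<partial>std_normal_vec I)"
proof -
  let ?G = "std_normal_vec I" and ?W = "\<lambda>x :: 'i \<Rightarrow> real. \<Sum>i\<in>I. (x i)\<^sup>2"
  let ?Q = "\<integral>\<^sup>+x. ennreal (q x) \<partial>?G" and ?R = "\<integral>\<^sup>+x. ennreal (q x * ?W x) \<partial>?G"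
  define c where "c = (1 / \<beta>\<^sup>2 - 1) / 2"
  have "c \<ge> 0" using \<beta> by (simp add: c_def power_le_one)
  have W_nonneg: "?W x \<ge> 0" for x by (simp add: sum_nonneg)
  have "q x \<le> \<beta> ^ card I * (exp (- c * ?W x) / \<beta> ^ card I * q x) + c * (q x * ?W x)" for x
    using mult_left_mono[OF exp_ge_add_one_self[of "- c * ?W x"] q_nonneg[of x]] \<beta>
    by (simp add: algebra_simps)
  then have "ennreal (q x)
    \<le> ennreal (\<beta> ^ card I) * (ennreal (exp (- c * ?W x) / \<beta> ^ card I) * ennreal (q x))
      + ennreal c * ennreal (q x * ?W x)" for x
    using W_nonneg q_nonneg \<open>c \<ge> 0\<close> \<beta>
    by (simp add: ennreal_mult[symmetric] ennreal_plus[symmetric] del: ennreal_plus)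
  then have "?Q
    \<le> (\<integral>\<^sup>+x. ennreal (\<beta> ^ card I) * (ennreal (exp (- c * ?W x) / \<beta> ^ card I) * ennreal (q x))
      + ennreal c * ennreal (q x * ?W x) \<partial>?G)"
    by (rule nn_integral_mono)
  also have "\<dots>
    = ennreal (\<beta> ^ card I) * (\<integral>\<^sup>+x. ennreal (exp (- c * ?W x) / \<beta> ^ card I) * ennreal (q x) \<partial>?G)
      + ennreal c * ?R"
    by (simp add: nn_integral_add nn_integral_cmult)
  also have "(\<integral>\<^sup>+x. ennreal (exp (- c * ?W x) / \<beta> ^ card I) * ennreal (q x) \<partial>?G) = ?Q"
    using nn_integral_std_normal_vec_mult[OF \<open>finite I\<close> \<beta>(1), of "\<lambda>x. ennreal (q x)"]
    by (simp add: q_scale c_def minus_divide_left)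
  finally show ?thesis by (simp add: c_def)
qed

text \<open>Equality holds, by independence of norm and direction, but this half follows from scaling alone.\<close>
lemma nn_integral_scale_invariant_mult_sum_squares_ge:
  fixes q :: "('i \<Rightarrow> real) \<Rightarrow> real"
  assumes "finite I" and q[measurable]: "q \<in> borel_measurable (PiM I (\<lambda>_. borel))"
    and q_nonneg: "\<And>x. 0 \<le> q x"
    and q_scale: "\<And>\<beta> x. \<beta> > 0 \<Longrightarrow> q (\<lambda>i\<in>I. \<beta> * x i) = q x"
    and finite: "(\<integral>\<^sup>+x. ennreal (q x) \<partial>std_normal_vec I) < \<infinity>"
  shows "of_nat (card I) * (\<integral>\<^sup>+x. ennreal (q x) \<partial>std_normal_vec I)
      \<le> (\<integral>\<^sup>+x. ennreal (q x * (\<Sum>i\<in>I. (x i)\<^sup>2)) \<partial>std_normal_vec I)" (is "_ * ?Q \<le> ?R")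
proof (cases "?R = \<top>")
  case True
  then show ?thesis by (metis top_greatest)
next
  case False
  then obtain r where r: "?R = ennreal r" "r \<ge> 0" by (cases ?R) auto
  obtain p where p: "?Q = ennreal p" "p \<ge> 0" using finite by (cases ?Q) auto
  have "of_nat (card I) * p \<le> r"
  proof (rule of_nat_mult_le_if_scaled_le)
    fix \<beta> :: real assume \<beta>: "0 < \<beta>" "\<beta> < 1"
    then have "(1 / \<beta>\<^sup>2 - 1) / 2 \<ge> 0" by (simp add: power_le_one)
    then show "p \<le> \<beta> ^ card I * p + (1 / \<beta>\<^sup>2 - 1) / 2 * r"
      using nn_integral_scale_invariant_le[OF \<open>finite I\<close> q q_nonneg q_scale[OF \<beta>(1)] \<beta>] \<beta> p(2) r(2)
      unfolding p(1) r(1)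
      by (simp add: ennreal_mult[symmetric] ennreal_plus[symmetric] del: ennreal_plus)
  qed
  then show ?thesis
    using p r by (simp add: ennreal_of_nat_eq_real_of_nat ennreal_mult[symmetric])
qed

lemma exp_ge_tangent:
  fixes a b :: real
  shows "exp b + (a - b) * exp b \<le> exp a"
proof -
  have "exp b * (1 + (a - b)) \<le> exp b * exp (a - b)"
    by (intro mult_left_mono exp_ge_add_one_self) simp
  then show ?thesis by (simp add: exp_add[symmetric] algebra_simps)
qed

text \<open>Jensen's inequality for \<open>exp\<close>, conditionally on the direction, through the tangent of \<open>exp\<close>.\<close>
lemma nn_integral_exp_scale_invariant_le:
  fixes u :: "('i \<Rightarrow> real) \<Rightarrow> real"
  assumes "finite I" and [measurable]: "u \<in> borel_measurable (PiM I (\<lambda>_. borel))"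
    and u: "\<And>x. 0 \<le> u x" "\<And>x. u x \<le> 1"
    and u_scale: "\<And>\<beta> x. \<beta> > 0 \<Longrightarrow> u (\<lambda>i\<in>I. \<beta> * x i) = u x"
    and "0 \<le> \<theta>"
  shows "(\<integral>\<^sup>+x. ennreal (exp (\<theta> * (card I * u x))) \<partial>std_normal_vec I)
      \<le> (\<integral>\<^sup>+x. ennreal (exp (\<theta> * (u x * (\<Sum>i\<in>I. (x i)\<^sup>2)))) \<partial>std_normal_vec I)"
    (is "?H \<le> ?E")
proof -
  let ?G = "std_normal_vec I" and ?W = "\<lambda>x. \<Sum>i\<in>I. (x i)\<^sup>2"
  define h where "h = (\<lambda>x. exp (\<theta> * (card I * u x)))"
  define q where "q = (\<lambda>x. \<theta> * u x * h x)"
  let ?Q = "\<integral>\<^sup>+x. ennreal (q x) \<partial>?G"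
  interpret prob_space ?G by (rule prob_space_std_normal_vec)
  have [measurable]: "h \<in> borel_measurable (PiM I (\<lambda>_. borel))"
    "q \<in> borel_measurable (PiM I (\<lambda>_. borel))"
    unfolding q_def h_def by measurable
  have q_nonneg: "0 \<le> q x" for x
    using u \<open>0 \<le> \<theta>\<close> by (simp add: q_def h_def)
  have "h x \<le> exp (\<theta> * real (card I))" for x
    using u \<open>0 \<le> \<theta>\<close> by (simp add: h_def mult_left_mono mult_left_le)
  then have "q x \<le> \<theta> * 1 * exp (\<theta> * real (card I))" for x
    unfolding q_def using u \<open>0 \<le> \<theta>\<close> by (intro mult_mono) (auto simp: h_def)
  then have "?Q \<le> (\<integral>\<^sup>+x. ennreal (\<theta> * 1 * exp (\<theta> * real (card I))) \<partial>?G)"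
    by (intro nn_integral_mono ennreal_leI)
  then have Q_finite: "?Q < \<infinity>"
    by (rule le_less_trans) (simp add: emeasure_space_1)
  have q_scale: "q (\<lambda>i\<in>I. \<beta> * x i) = q x" if "\<beta> > 0" for \<beta> x
    using that by (simp add: q_def h_def u_scale)
  have tangent: "h x + q x * ?W x \<le> exp (\<theta> * (u x * ?W x)) + card I * q x" for x
    using exp_ge_tangent[of "\<theta> * (card I * u x)" "\<theta> * (u x * ?W x)"]
    by (simp add: q_def h_def algebra_simps)
  have "?H + of_nat (card I) * ?Q \<le> ?H + (\<integral>\<^sup>+x. ennreal (q x * ?W x) \<partial>?G)"
    by (intro add_left_mono nn_integral_scale_invariant_mult_sum_squares_ge
        \<open>finite I\<close> q_nonneg q_scale Q_finite) measurable
  also have "\<dots> = (\<integral>\<^sup>+x. ennreal (h x + q x * ?W x) \<partial>?G)"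
    unfolding h_def[symmetric]
    using q_nonneg by (subst nn_integral_add[symmetric]) (auto simp: ennreal_plus h_def sum_nonneg)
  also have "\<dots> \<le> (\<integral>\<^sup>+x. ennreal (exp (\<theta> * (u x * ?W x)) + card I * q x) \<partial>?G)"
    by (intro nn_integral_mono ennreal_leI tangent)
  also have "\<dots> = ?E + of_nat (card I) * ?Q"
    using q_nonneg
    by (simp add: ennreal_plus ennreal_mult nn_integral_add nn_integral_cmult
        ennreal_of_nat_eq_real_of_nat)
  finally show ?thesis
    using Q_finite
    by (auto simp: ennreal_add_left_cancel_le ennreal_mult_eq_top_iff
        add.commute[of _ "of_nat (card I) * ?Q"])
qed

lemma nn_integral_exp_normalized_le:
  assumes "finite I" and z: "(\<Sum>i\<in>I. (z i)\<^sup>2) = 1" and \<theta>: "0 \<le> \<theta>" "\<theta> < 1 / 2"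
  shows "(\<integral>\<^sup>+x. ennreal (exp (\<theta> * (card I * (\<Sum>i\<in>I. z i * normalized I x i)\<^sup>2))) \<partial>std_normal_vec I)
    \<le> ennreal (1 / sqrt (1 - 2 * \<theta>))"
proof -
  let ?G = "std_normal_vec I"
  have "(\<integral>\<^sup>+x. ennreal (exp (\<theta> * (card I * (\<Sum>i\<in>I. z i * normalized I x i)\<^sup>2))) \<partial>?G)
      \<le> (\<integral>\<^sup>+x. ennreal (exp (\<theta> * ((\<Sum>i\<in>I. z i * normalized I x i)\<^sup>2 * (\<Sum>i\<in>I. (x i)\<^sup>2)))) \<partial>?G)"
    using \<open>finite I\<close> power2_sum_mult_normalized_le[OF z] \<theta>(1)
    by (intro nn_integral_exp_scale_invariant_le) (auto simp: sum_mult_normalized_scale)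
  also have "\<dots> = (\<integral>\<^sup>+x. ennreal (exp (\<theta> * (\<Sum>i\<in>I. z i * x i)\<^sup>2)) \<partial>?G)"
    by (simp only: power2_sum_mult_normalized_mult[OF \<open>finite I\<close>])
  also have "\<dots> = (\<integral>\<^sup>+t. ennreal (exp (\<theta> * t\<^sup>2)) \<partial>std_normal)"
    using distributed_nn_integral[OF distributed_std_normal_vec_linear[OF \<open>finite I\<close>, of z],
        of "\<lambda>t. ennreal (exp (\<theta> * t\<^sup>2))"]
    by (simp add: z nn_integral_density)
  also have "\<dots> = ennreal (1 / sqrt (1 - 2 * \<theta>))"
    using \<theta>(2) by (rule nn_integral_exp_square_std_normal)
  finally show ?thesis .
qed

section \<open>Nets of the sphere from integer points\<close>

definition integer_l1_ball :: "'i set \<Rightarrow> nat \<Rightarrow> ('i \<Rightarrow> int) set" where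
  "integer_l1_ball I R = {z \<in> extensional I. (\<Sum>i\<in>I. nat \<bar>z i\<bar>) \<le> R}"

lemma integer_l1_ball_subset:
  assumes "finite I"
  shows "integer_l1_ball I R \<subseteq> (\<Pi>\<^sub>E i\<in>I. {- int R..int R})"
proof
  fix z assume z: "z \<in> integer_l1_ball I R"
  have "z i \<in> {- int R..int R}" if "i \<in> I" for i
  proof -
    have "nat \<bar>z i\<bar> \<le> R"
      using z member_le_sum[OF that, of "\<lambda>i. nat \<bar>z i\<bar>"] assms by (simp add: integer_l1_ball_def)
    then show ?thesis by auto
  qed
  then show "z \<in> (\<Pi>\<^sub>E i\<in>I. {- int R..int R})"
    using z by (simp add: integer_l1_ball_def PiE_iff)
qed

lemma finite_integer_l1_ball: "finite I \<Longrightarrow> finite (integer_l1_ball I R)"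
  by (rule finite_subset[OF integer_l1_ball_subset]) (auto intro: finite_PiE)

lemma sum_half_power_abs_le: "(\<Sum>z\<in>{- int R..int R}. (1 / 2 :: real) ^ nat \<bar>z\<bar>) \<le> 3"
proof -
  have "(\<Sum>z\<in>{- int R..int R}. (1 / 2 :: real) ^ nat \<bar>z\<bar>) = 3 - 2 * (1 / 2) ^ R"
  proof (induction R)
    case (Suc R)
    have "{- int (Suc R)..int (Suc R)} = insert (int (Suc R)) (insert (- int (Suc R)) {- int R..int R})"
      by auto
    then show ?case using Suc by (simp add: nat_add_distrib)
  qed simp
  then show ?thesis by simp
qed

lemma card_integer_l1_ball_le:
  assumes "finite I"
  shows "real (card (integer_l1_ball I R)) \<le> 2 ^ R * 3 ^ card I"
proof -
  let ?box = "\<Pi>\<^sub>E i\<in>I. {- int R..int R}"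
  have "real (card (integer_l1_ball I R)) * (1 / 2) ^ R = (\<Sum>z\<in>integer_l1_ball I R. (1 / 2 :: real) ^ R)"
    by simp
  also have "\<dots> \<le> (\<Sum>z\<in>integer_l1_ball I R. (1 / 2 :: real) ^ (\<Sum>i\<in>I. nat \<bar>z i\<bar>))"
    by (intro sum_mono power_decreasing) (auto simp: integer_l1_ball_def)
  also have "\<dots> \<le> (\<Sum>z\<in>?box. (1 / 2 :: real) ^ (\<Sum>i\<in>I. nat \<bar>z i\<bar>))"
    using assms by (intro sum_mono2 integer_l1_ball_subset finite_PiE) auto
  also have "\<dots> = (\<Sum>z\<in>?box. \<Prod>i\<in>I. (1 / 2 :: real) ^ nat \<bar>z i\<bar>)"
    by (simp add: power_sum)
  also have "\<dots> = (\<Prod>i\<in>I. \<Sum>z\<in>{- int R..int R}. (1 / 2 :: real) ^ nat \<bar>z\<bar>)"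
    using assms by (subst prod_sum_PiE) auto
  also have "\<dots> \<le> (\<Prod>i\<in>I. 3)"
    by (intro prod_mono conjI sum_nonneg sum_half_power_abs_le) auto
  finally show ?thesis by (simp add: power_divide field_simps)
qed

lemma power2_sum_mult_ge_if_close:
  fixes u z :: "'i \<Rightarrow> real"
  assumes "(\<Sum>i\<in>I. (u i - z i)\<^sup>2) \<le> \<epsilon> * (\<Sum>i\<in>I. (u i)\<^sup>2)" "\<epsilon> \<le> 1"
  shows "(1 - \<epsilon>) * (\<Sum>i\<in>I. (u i)\<^sup>2) * (\<Sum>i\<in>I. (z i)\<^sup>2) \<le> (\<Sum>i\<in>I. u i * z i)\<^sup>2"
proof -
  define a where "a = (1 - \<epsilon>) * (\<Sum>i\<in>I. (u i)\<^sup>2)"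
  define b where "b = (\<Sum>i\<in>I. (z i)\<^sup>2)"
  have "a \<ge> 0" "b \<ge> 0" using assms(2) by (auto simp: a_def b_def intro!: mult_nonneg_nonneg sum_nonneg)
  have "(\<Sum>i\<in>I. (u i - z i)\<^sup>2) = (\<Sum>i\<in>I. (u i)\<^sup>2) + b - 2 * (\<Sum>i\<in>I. u i * z i)"
    by (simp add: b_def power2_diff sum.distrib sum_subtractf sum_distrib_left mult_ac)
  then have "a + b \<le> 2 * (\<Sum>i\<in>I. u i * z i)"
    using assms(1) by (simp add: a_def algebra_simps)
  then have "(a + b)\<^sup>2 \<le> (2 * (\<Sum>i\<in>I. u i * z i))\<^sup>2"
    using \<open>a \<ge> 0\<close> \<open>b \<ge> 0\<close> by (intro power_mono) auto
  moreover have "4 * (a * b) \<le> (a + b)\<^sup>2"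
    using zero_le_power2[of "a - b"] by (simp add: power2_eq_square algebra_simps)
  ultimately show ?thesis
    by (simp add: a_def b_def power_mult_distrib)
qed

lemma round_mem_integer_l1_ball:
  assumes "finite I" and u: "(\<Sum>i\<in>I. (u i)\<^sup>2) = real (card I)"
  shows "(\<lambda>i\<in>I. round (u i)) \<in> integer_l1_ball I (3 * card I div 2)"
proof -
  have "real (\<Sum>i\<in>I. nat \<bar>round (u i)\<bar>) \<le> (\<Sum>i\<in>I. 1 * \<bar>u i\<bar> + 1 / 2)"
    unfolding of_nat_sum
  proof (rule sum_mono)
    fix i
    show "real (nat \<bar>round (u i)\<bar>) \<le> 1 * \<bar>u i\<bar> + 1 / 2"
      using of_int_round_abs_le[of "u i"] by linarith
  qed
  also have "\<dots> = (\<Sum>i\<in>I. \<bar>1\<bar> * \<bar>u i\<bar>) + card I / 2"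
    by (simp add: sum.distrib)
  also have "\<dots> \<le> L2_set (\<lambda>_. 1) I * L2_set u I + card I / 2"
    by (intro add_right_mono L2_set_mult_ineq)
  also have "\<dots> = 3 * card I / 2"
    using u by (simp add: L2_set_def)
  finally have "2 * (\<Sum>i\<in>I. nat \<bar>round (u i)\<bar>) \<le> 3 * card I"
    by linarith
  then show ?thesis
    by (simp add: integer_l1_ball_def less_eq_div_iff_mult_less_eq mult.commute)
qed

lemma integer_point_near_direction:
  assumes "finite I" and y: "(\<Sum>i\<in>I. (y i)\<^sup>2) \<noteq> 0"
  obtains z where "z \<in> integer_l1_ball I (3 * card I div 2)" "\<exists>i\<in>I. z i \<noteq> 0"
    "3 / 4 * (\<Sum>i\<in>I. (y i)\<^sup>2) * (\<Sum>i\<in>I. (real_of_int (z i))\<^sup>2) \<le> (\<Sum>i\<in>I. y i * real_of_int (z i))\<^sup>2"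
proof -
  have "I \<noteq> {}" "L2_set y I \<noteq> 0"
    using y by (auto simp: power2_L2_set[symmetric])
  then have "card I > 0" "L2_set y I > 0"
    using assms by (simp_all add: card_gt_0_iff less_le)
  define s where "s = sqrt (card I) / L2_set y I"
  define z where "z = (\<lambda>i\<in>I. round (s * y i))"
  have "s > 0" using \<open>card I > 0\<close> \<open>L2_set y I > 0\<close> by (simp add: s_def)
  have "(\<Sum>i\<in>I. (s * y i)\<^sup>2) = s\<^sup>2 * (\<Sum>i\<in>I. (y i)\<^sup>2)"
    by (simp add: power_mult_distrib sum_distrib_left)
  then have u: "(\<Sum>i\<in>I. (s * y i)\<^sup>2) = card I"
    using \<open>L2_set y I > 0\<close> by (simp add: s_def power_divide power2_L2_set[symmetric])
  have "(\<Sum>i\<in>I. (s * y i - z i)\<^sup>2) \<le> (\<Sum>i\<in>I. (1 / 2)\<^sup>2)"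
    using of_int_round_abs_le
    by (intro sum_mono) (simp add: z_def abs_le_square_iff[symmetric] abs_minus_commute)
  then have close: "(\<Sum>i\<in>I. (s * y i - z i)\<^sup>2) \<le> 1 / 4 * (\<Sum>i\<in>I. (s * y i)\<^sup>2)"
    unfolding u by (simp add: power_divide)
  have "s\<^sup>2 * (3 / 4 * (\<Sum>i\<in>I. (y i)\<^sup>2) * (\<Sum>i\<in>I. (real_of_int (z i))\<^sup>2))
      \<le> s\<^sup>2 * (\<Sum>i\<in>I. y i * real_of_int (z i))\<^sup>2"
    using power2_sum_mult_ge_if_close[OF close]
    by (simp add: power_mult_distrib sum_distrib_left[symmetric] mult_ac)
  then have angle: "3 / 4 * (\<Sum>i\<in>I. (y i)\<^sup>2) * (\<Sum>i\<in>I. (real_of_int (z i))\<^sup>2)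
      \<le> (\<Sum>i\<in>I. y i * real_of_int (z i))\<^sup>2"
    using \<open>s > 0\<close> by simp
  have "z \<in> integer_l1_ball I (3 * card I div 2)"
    unfolding z_def using \<open>finite I\<close> u by (rule round_mem_integer_l1_ball)
  moreover have "\<exists>i\<in>I. z i \<noteq> 0"
  proof (rule ccontr)
    assume "\<not> ?thesis"
    then have "(\<Sum>i\<in>I. (s * y i - z i)\<^sup>2) = (\<Sum>i\<in>I. (s * y i)\<^sup>2)" by simp
    with close u \<open>card I > 0\<close> show False by simp
  qed
  ultimately show thesis using angle by (rule that)
qed

lemma card_integer_l1_ball_three_halves_le:
  assumes "finite I"
  shows "real (card (integer_l1_ball I (3 * card I div 2))) \<le> 9 ^ card I"
proof -
  let ?R = "3 * card I div 2"
  have "(2 ^ ?R)\<^sup>2 = (2 ^ (2 * ?R) :: real)" by (simp add: power_mult[symmetric] mult.commute)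
  also have "\<dots> \<le> 2 ^ (3 * card I)" by (intro power_increasing) auto
  also have "\<dots> \<le> 9 ^ card I" by (simp add: power_mult power_mono)
  also have "\<dots> = (3 ^ card I)\<^sup>2" by (simp add: power2_eq_square power_mult_distrib[symmetric])
  finally have "2 ^ ?R \<le> (3 ^ card I :: real)" by (rule power2_le_imp_le) simp
  have "real (card (integer_l1_ball I ?R)) \<le> 2 ^ ?R * 3 ^ card I"
    using assms by (rule card_integer_l1_ball_le)
  also have "\<dots> \<le> 3 ^ card I * 3 ^ card I"
    using \<open>2 ^ ?R \<le> 3 ^ card I\<close> by (intro mult_right_mono) auto
  also have "\<dots> = 9 ^ card I"
    by (simp add: power_mult_distrib[symmetric])
  finally show ?thesis .
qed

lemma sphere_net_exists:
  fixes I :: "'i set"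
  assumes "finite I"
  obtains Z :: "('i \<Rightarrow> real) set"
  where "finite Z" "real (card Z) \<le> 9 ^ card I" "\<forall>z\<in>Z. (\<Sum>i\<in>I. (z i)\<^sup>2) = 1"
    "\<forall>y. (\<Sum>i\<in>I. (y i)\<^sup>2) \<noteq> 0 \<longrightarrow> (\<exists>z\<in>Z. 3 / 4 * (\<Sum>i\<in>I. (y i)\<^sup>2) \<le> (\<Sum>i\<in>I. y i * z i)\<^sup>2)"
proof -
  let ?ball = "integer_l1_ball I (3 * card I div 2)"
  define direction where "direction = (\<lambda>z :: 'i \<Rightarrow> int. normalized I (\<lambda>i. real_of_int (z i)))"
  define Z where "Z = direction ` {z \<in> ?ball. \<exists>i\<in>I. z i \<noteq> 0}"
  have finite_ball: "finite ?ball" using assms by (rule finite_integer_l1_ball)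
  then have "card Z \<le> card ?ball"
    unfolding Z_def by (intro order_trans[OF card_image_le card_mono]) auto
  then have "real (card Z) \<le> 9 ^ card I"
    using card_integer_l1_ball_three_halves_le[OF assms] by linarith
  moreover have "(\<Sum>i\<in>I. (z i)\<^sup>2) = 1" if "z \<in> Z" for z
    using that assms by (auto simp: Z_def direction_def sum_power2_normalized L2_set_eq_0_iff)
  moreover have "\<exists>z\<in>Z. 3 / 4 * (\<Sum>i\<in>I. (y i)\<^sup>2) \<le> (\<Sum>i\<in>I. y i * z i)\<^sup>2"
    if y: "(\<Sum>i\<in>I. (y i)\<^sup>2) \<noteq> 0" for y
  proof -
    obtain z where z: "z \<in> ?ball" "\<exists>i\<in>I. z i \<noteq> 0"
      and angle: "3 / 4 * (\<Sum>i\<in>I. (y i)\<^sup>2) * (\<Sum>i\<in>I. (real_of_int (z i))\<^sup>2)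
        \<le> (\<Sum>i\<in>I. y i * real_of_int (z i))\<^sup>2"
      using integer_point_near_direction[OF assms y] by blast
    have "(\<Sum>i\<in>I. (real_of_int (z i))\<^sup>2) > 0"
      using z(2) assms by (auto intro!: sum_pos2)
    then have "3 / 4 * (\<Sum>i\<in>I. (y i)\<^sup>2) \<le> (\<Sum>i\<in>I. y i * direction z i)\<^sup>2"
      using angle
      by (simp add: direction_def sum_mult_normalized power_divide power2_L2_set pos_le_divide_eq)
    then show ?thesis using z by (auto simp: Z_def)
  qed
  ultimately show thesis
    using finite_ball by (intro that[of Z]) (auto simp: Z_def)
qed

lemma sum_squares_transpose_le_if_net:
  fixes U :: "'j \<Rightarrow> 'i \<Rightarrow> real"
  assumes "\<kappa> > 0" "\<beta> \<ge> 0"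
    and net: "(\<Sum>l\<in>I. (\<Sum>j\<in>S. U j l * c j)\<^sup>2) \<noteq> 0 \<Longrightarrow>
      \<exists>z\<in>Z. \<kappa> * (\<Sum>l\<in>I. (\<Sum>j\<in>S. U j l * c j)\<^sup>2) \<le> (\<Sum>l\<in>I. (\<Sum>j\<in>S. U j l * c j) * z l)\<^sup>2"
    and U: "\<And>z. z \<in> Z \<Longrightarrow> (\<Sum>j\<in>S. (\<Sum>l\<in>I. z l * U j l)\<^sup>2) \<le> \<kappa> * \<beta>"
  shows "(\<Sum>l\<in>I. (\<Sum>j\<in>S. U j l * c j)\<^sup>2) \<le> \<beta> * (\<Sum>j\<in>S. (c j)\<^sup>2)"
proof (cases "(\<Sum>l\<in>I. (\<Sum>j\<in>S. U j l * c j)\<^sup>2) = 0")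
  case True
  then show ?thesis using \<open>\<beta> \<ge> 0\<close> by (simp add: sum_nonneg)
next
  case False
  then obtain z where "z \<in> Z"
    and "\<kappa> * (\<Sum>l\<in>I. (\<Sum>j\<in>S. U j l * c j)\<^sup>2) \<le> (\<Sum>l\<in>I. (\<Sum>j\<in>S. U j l * c j) * z l)\<^sup>2"
    using net by blast
  note this(2)
  also have "(\<Sum>l\<in>I. (\<Sum>j\<in>S. U j l * c j) * z l) = (\<Sum>j\<in>S. c j * (\<Sum>l\<in>I. z l * U j l))"
    unfolding sum_distrib_left sum_distrib_right by (subst sum.swap) (simp add: mult_ac)
  also have "(\<Sum>j\<in>S. c j * (\<Sum>l\<in>I. z l * U j l))\<^sup>2 \<le> (\<Sum>j\<in>S. (c j)\<^sup>2) * (\<Sum>j\<in>S. (\<Sum>l\<in>I. z l * U j l)\<^sup>2)"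
    by (rule Cauchy_Schwarz_ineq_sum)
  also have "\<dots> \<le> (\<Sum>j\<in>S. (c j)\<^sup>2) * (\<kappa> * \<beta>)"
    using U[OF \<open>z \<in> Z\<close>] by (intro mult_left_mono sum_nonneg) auto
  finally have "\<kappa> * (\<Sum>l\<in>I. (\<Sum>j\<in>S. U j l * c j)\<^sup>2) \<le> \<kappa> * (\<beta> * (\<Sum>j\<in>S. (c j)\<^sup>2))"
    by (simp add: mult_ac)
  then show ?thesis using \<open>\<kappa> > 0\<close> by simp
qed

section \<open>The matrix of row directions\<close>

definition sign_matrix :: "nat \<Rightarrow> (nat \<times> nat \<Rightarrow> real) \<Rightarrow> nat \<Rightarrow> nat \<Rightarrow> real" where
  "sign_matrix L \<Phi> j = normalized {..<L} (\<lambda>l. \<Phi> (j, l))"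

definition sign_matrix_form :: "nat set \<Rightarrow> nat \<Rightarrow> (nat \<Rightarrow> real) \<Rightarrow> (nat \<times> nat \<Rightarrow> real) \<Rightarrow> real" where
  "sign_matrix_form S L z \<Phi> = (\<Sum>j\<in>S. (\<Sum>l<L. z l * sign_matrix L \<Phi> j l)\<^sup>2)"

lemma prob_space_gauss_entries: "prob_space (gauss_entries S L)"
  unfolding gauss_entries_def by (rule prob_space_std_normal_vec)

lemma measurable_sign_matrix_form [measurable]:
  "sign_matrix_form S L z \<in> borel_measurable (gauss_entries S L)"
proof -
  have [measurable]: "(\<lambda>\<Phi>. \<Phi> (j, l)) \<in> borel_measurable (gauss_entries S L)"
    if "j \<in> S" "l \<in> {..<L}" for j l
    unfolding gauss_entries_def
    using measurable_component_singleton[of "(j, l)" "S \<times> {..<L}" "\<lambda>_. std_normal"] that by simp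
  show ?thesis
    unfolding sign_matrix_form_def[abs_def] sign_matrix_def sum_mult_normalized L2_set_def by measurable
qed

lemma nn_integral_exp_sign_matrix_form_le:
  assumes "finite S" and z: "(\<Sum>l<L. (z l)\<^sup>2) = 1" and \<theta>: "0 \<le> \<theta>" "\<theta> < 1 / 2"
  shows "(\<integral>\<^sup>+\<Phi>. ennreal (exp (\<theta> * real L * sign_matrix_form S L z \<Phi>)) \<partial>gauss_entries S L)
    \<le> ennreal ((1 / sqrt (1 - 2 * \<theta>)) ^ card S)"
proof -
  define f :: "(nat \<Rightarrow> real) \<Rightarrow> ennreal" where
    "f = (\<lambda>x. ennreal (exp (\<theta> * (L * (\<Sum>l<L. z l * normalized {..<L} x l)\<^sup>2))))"
  have [measurable]: "f \<in> borel_measurable (PiM {..<L} (\<lambda>_. borel))"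
    unfolding f_def by measurable
  have f_row: "f (\<lambda>l\<in>{..<L}. \<Phi> (j, l))
      = ennreal (exp (\<theta> * L * (\<Sum>l<L. z l * sign_matrix L \<Phi> j l)\<^sup>2))" for \<Phi> j
    by (simp add: f_def sign_matrix_def sum_mult_normalized mult.assoc cong: L2_set_cong_simp)
  have "(\<integral>\<^sup>+\<Phi>. ennreal (exp (\<theta> * real L * sign_matrix_form S L z \<Phi>)) \<partial>gauss_entries S L)
     = (\<integral>\<^sup>+\<Phi>. (\<Prod>j\<in>S. f (\<lambda>l\<in>{..<L}. \<Phi> (j, l))) \<partial>std_normal_vec (S \<times> {..<L}))"
    unfolding gauss_entries_def f_row sign_matrix_form_def sum_distrib_left
    by (simp add: exp_sum \<open>finite S\<close> prod_ennreal)
  also have "\<dots> = (\<Prod>j\<in>S. \<integral>\<^sup>+x. f x \<partial>std_normal_vec {..<L})"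
    using \<open>finite S\<close> by (intro nn_integral_PiM_Times prob_space_std_normal) auto
  also have "\<dots> \<le> (\<Prod>j\<in>S. ennreal (1 / sqrt (1 - 2 * \<theta>)))"
    using nn_integral_exp_normalized_le[of "{..<L}" z \<theta>] z \<theta>
    by (intro prod_mono_ennreal) (simp add: f_def)
  also have "\<dots> = ennreal ((1 / sqrt (1 - 2 * \<theta>)) ^ card S)"
    using \<theta> by (simp add: ennreal_power)
  finally show ?thesis .
qed

lemma prob_sign_matrix_form_ge_le:
  assumes "finite S" "L > 0" and z: "(\<Sum>l<L. (z l)\<^sup>2) = 1" and \<theta>: "0 < \<theta>" "\<theta> < 1 / 2"
  shows "measure (gauss_entries S L) {\<Phi> \<in> space (gauss_entries S L). t \<le> sign_matrix_form S L z \<Phi>}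
    \<le> exp (- (\<theta> * real L) * t) * (1 / sqrt (1 - 2 * \<theta>)) ^ card S"
proof -
  let ?M = "gauss_entries S L" and ?Q = "sign_matrix_form S L z"
  interpret prob_space ?M by (rule prob_space_gauss_entries)
  have "emeasure ?M {\<Phi> \<in> space ?M. t \<le> ?Q \<Phi>}
      \<le> ennreal (exp (- (\<theta> * real L) * t))
        * (\<integral>\<^sup>+\<Phi>. ennreal (exp (\<theta> * real L * ?Q \<Phi>)) * indicator (space ?M) \<Phi> \<partial>?M)"
    using \<theta> \<open>L > 0\<close> by (intro Chernoff_ineq_nn_integral_ge) auto
  also have "(\<integral>\<^sup>+\<Phi>. ennreal (exp (\<theta> * real L * ?Q \<Phi>)) * indicator (space ?M) \<Phi> \<partial>?M)
      = (\<integral>\<^sup>+\<Phi>. ennreal (exp (\<theta> * real L * ?Q \<Phi>)) \<partial>?M)"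
    by (intro nn_integral_cong) simp
  also have "\<dots> \<le> ennreal ((1 / sqrt (1 - 2 * \<theta>)) ^ card S)"
    using \<theta> by (intro nn_integral_exp_sign_matrix_form_le \<open>finite S\<close> z) auto
  finally show ?thesis
    using \<theta> by (simp add: emeasure_eq_measure ennreal_mult[symmetric] mult_left_mono)
qed

lemma prob_sign_matrix_form_large_le:
  assumes "finite S" "L > 0" and z: "(\<Sum>l<L. (z l)\<^sup>2) = 1"
  defines "t \<equiv> 3 / 4 * (9 + 4 * real (card S) / real L)"
  shows "measure (gauss_entries S L) {\<Phi> \<in> space (gauss_entries S L). t \<le> sign_matrix_form S L z \<Phi>}
    \<le> exp (- (81 / 32)) ^ L"
proof -
  let ?k = "real (card S)"
  have "measure (gauss_entries S L) {\<Phi> \<in> space (gauss_entries S L). t \<le> sign_matrix_form S L z \<Phi>}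
    \<le> exp (- (3 / 8 * real L) * t) * (1 / sqrt (1 - 2 * (3 / 8))) ^ card S"
    using assms by (intro prob_sign_matrix_form_ge_le) auto
  also have "- (3 / 8 * real L) * t = L * - (81 / 32) + ?k * - (9 / 8)"
    using \<open>L > 0\<close> by (simp add: t_def field_simps)
  also have "1 / sqrt (1 - 2 * (3 / 8)) = (2 :: real)"
    by (simp add: real_sqrt_divide)
  also have "exp (L * - (81 / 32) + ?k * - (9 / 8)) * 2 ^ card S
      = exp (- (81 / 32)) ^ L * (exp (- (9 / 8)) * 2) ^ card S"
    by (simp only: exp_add exp_of_nat_mult power_mult_distrib mult.assoc)
  also have "\<dots> \<le> exp (- (81 / 32)) ^ L * 1"
  proof (intro mult_left_mono power_le_one)
    show "exp (- (9 / 8)) * 2 \<le> (1 :: real)"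
      using exp_ge_add_one_self[of "9 / 8 :: real"] by (simp add: exp_minus field_simps)
  qed auto
  finally show ?thesis by simp
qed

lemma nine_mult_exp_le: "9 * exp (- (81 / 32)) \<le> exp (- (1 / 8) :: real)"
proof -
  have "(9::real) \<le> (178 / 100) ^ 4" by (simp add: power_divide)
  also have "\<dots> \<le> exp (3 / 5) ^ 4"
    using exp_lower_Taylor_quadratic[of "3 / 5 :: real"]
    by (intro power_mono) (auto simp: power2_eq_square)
  also have "\<dots> = exp (12 / 5)" by (simp add: exp_of_nat_mult[symmetric])
  also have "\<dots> \<le> exp (77 / 32)" by simp
  finally have "9 * exp (- (81 / 32)) \<le> exp (77 / 32) * exp (- (81 / 32) :: real)"
    by (intro mult_right_mono) auto
  then show ?thesis by (simp add: exp_add[symmetric])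
qed

lemma norm2S_of_real_matrix_le:
  assumes "\<And>x :: nat \<Rightarrow> real. (\<Sum>l\<in>I. (\<Sum>j\<in>S. U j l * x j)\<^sup>2) \<le> \<beta> * (\<Sum>j\<in>S. (x j)\<^sup>2)"
  shows "norm2S I (\<lambda>l. \<Sum>j\<in>S. complex_of_real (U j l) * c j) \<le> sqrt \<beta> * norm2S S c"
proof -
  have "(\<Sum>l\<in>I. (cmod (\<Sum>j\<in>S. complex_of_real (U j l) * c j))\<^sup>2)
      = (\<Sum>l\<in>I. (\<Sum>j\<in>S. U j l * Re (c j))\<^sup>2) + (\<Sum>l\<in>I. (\<Sum>j\<in>S. U j l * Im (c j))\<^sup>2)"
    by (simp add: cmod_power2 sum.distrib)
  also have "\<dots> \<le> \<beta> * (\<Sum>j\<in>S. (Re (c j))\<^sup>2) + \<beta> * (\<Sum>j\<in>S. (Im (c j))\<^sup>2)"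
    by (intro add_mono assms)
  also have "\<dots> = \<beta> * (\<Sum>j\<in>S. (cmod (c j))\<^sup>2)"
    by (simp add: cmod_power2 sum.distrib distrib_left)
  finally show ?thesis
    by (simp add: norm2S_def real_sqrt_mult[symmetric])
qed

lemma sign_matrix_norm_event:
  assumes "finite S" "L > 0"
  obtains good where "good \<in> sets (gauss_entries S L)"
    "1 - exp (- real L / 8) \<le> measure (gauss_entries S L) good"
    "\<And>\<Phi> c. \<Phi> \<in> good \<Longrightarrow> norm2S {..<L} (\<lambda>l. \<Sum>j\<in>S. complex_of_real (sign_matrix L \<Phi> j l) * c j)
       \<le> sqrt (9 + 4 * real (card S) / real L) * norm2S S c"
proof -
  let ?M = "gauss_entries S L"
  interpret prob_space ?M by (rule prob_space_gauss_entries)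
  obtain Z :: "(nat \<Rightarrow> real) set"
    where Z: "finite Z" "real (card Z) \<le> 9 ^ L" "\<forall>z\<in>Z. (\<Sum>l<L. (z l)\<^sup>2) = 1"
      and net: "\<forall>y. (\<Sum>l<L. (y l)\<^sup>2) \<noteq> 0 \<longrightarrow> (\<exists>z\<in>Z. 3 / 4 * (\<Sum>l<L. (y l)\<^sup>2) \<le> (\<Sum>l<L. y l * z l)\<^sup>2)"
    using sphere_net_exists[of "{..<L}"] by auto
  define \<beta> where "\<beta> = 9 + 4 * real (card S) / real L"
  have "\<beta> \<ge> 0" by (simp add: \<beta>_def)
  define large where "large = (\<lambda>z. {\<Phi> \<in> space ?M. 3 / 4 * \<beta> \<le> sign_matrix_form S L z \<Phi>})"
  have large_sets: "large z \<in> sets ?M" for z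
    unfolding large_def by measurable
  define good where "good = space ?M - (\<Union>z\<in>Z. large z)"
  have "prob (\<Union>z\<in>Z. large z) \<le> (\<Sum>z\<in>Z. prob (large z))"
    using Z(1) large_sets by (intro finite_measure_subadditive_finite) auto
  also have "\<dots> \<le> (\<Sum>z\<in>Z. exp (- (81 / 32)) ^ L)"
    unfolding large_def \<beta>_def using Z(3) by (intro sum_mono prob_sign_matrix_form_large_le assms) auto
  also have "\<dots> \<le> 9 ^ L * exp (- (81 / 32)) ^ L"
    using Z(2) by (simp add: mult_right_mono)
  also have "\<dots> \<le> exp (- (1 / 8)) ^ L"
    unfolding power_mult_distrib[symmetric] by (intro power_mono nine_mult_exp_le) auto
  also have "\<dots> = exp (- real L / 8)" by (simp add: exp_of_nat_mult[symmetric])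
  finally have "1 - exp (- real L / 8) \<le> prob good"
    unfolding good_def using Z(1) large_sets by (subst prob_compl) auto
  moreover have "good \<in> sets ?M"
    unfolding good_def using Z(1) large_sets by auto
  moreover have "norm2S {..<L} (\<lambda>l. \<Sum>j\<in>S. complex_of_real (sign_matrix L \<Phi> j l) * c j)
      \<le> sqrt \<beta> * norm2S S c" if "\<Phi> \<in> good" for \<Phi> c
  proof (rule norm2S_of_real_matrix_le[OF sum_squares_transpose_le_if_net[of "3 / 4" \<beta>]])
    show "(\<Sum>j\<in>S. (\<Sum>l<L. z l * sign_matrix L \<Phi> j l)\<^sup>2) \<le> 3 / 4 * \<beta>" if "z \<in> Z" for z
      using \<open>\<Phi> \<in> good\<close> that
      by (auto simp: good_def large_def sign_matrix_form_def not_le intro: less_imp_le)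
  qed (use net \<open>\<beta> \<ge> 0\<close> in auto)
  ultimately show thesis
    using that unfolding \<beta>_def by blast
qed

section \<open>Recovery\<close>

lemma unique_l21_solution_if_sign_matrix:
  assumes "full_col_rank_on A n S" "S \<subseteq> {..<N}" and \<sigma>: "\<forall>j\<in>S. \<sigma> j > 0"
    and dual: "\<And>m. m \<in> {..<N} - S \<Longrightarrow>
      norm2S {..<L} (certificate_column A n S (\<lambda>j l. complex_of_real (sign_matrix L \<Phi> j l)) m) < 1"
  shows "unique_l21_solution A n N L (X_of S \<sigma> \<Phi>)"
proof (rule unique_l21_solution_dual_certificate[OF assms(1,2) _ _ _ dual])
  show "X_of S \<sigma> \<Phi> j l = 0" if "j \<notin> S" for j l
    using that by (simp add: X_of_def)
  show "norm2S {..<L} (\<lambda>l. complex_of_real (sign_matrix L \<Phi> j l)) \<le> 1" for j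
    by (simp add: norm2S_def sign_matrix_def sum_power2_normalized)
  fix j assume "j \<in> S"
  have "(\<Sum>l<L. \<Phi> (j, l) * sign_matrix L \<Phi> j l) = L2_set (\<lambda>l. \<Phi> (j, l)) {..<L}"
    unfolding sign_matrix_def sum_mult_normalized power2_eq_square[symmetric] power2_L2_set[symmetric]
    by (simp add: power2_eq_square)
  moreover have "(\<Sum>l<L. complex_of_real (sign_matrix L \<Phi> j l) * X_of S \<sigma> \<Phi> j l)
      = complex_of_real (\<sigma> j * (\<Sum>l<L. \<Phi> (j, l) * sign_matrix L \<Phi> j l))"
    using \<open>j \<in> S\<close> by (simp add: X_of_def sum_distrib_left mult_ac)
  moreover have "norm2S {..<L} (X_of S \<sigma> \<Phi> j) = \<sigma> j * L2_set (\<lambda>l. \<Phi> (j, l)) {..<L}"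
    using \<open>j \<in> S\<close> bspec[OF \<sigma> \<open>j \<in> S\<close>]
    by (simp add: norm2S_def X_of_def L2_set_def norm_mult power_mult_distrib
        sum_distrib_left[symmetric] real_sqrt_mult)
  ultimately show "(\<Sum>l<L. complex_of_real (sign_matrix L \<Phi> j l) * X_of S \<sigma> \<Phi> j l)
      = complex_of_real (norm2S {..<L} (X_of S \<sigma> \<Phi> j))"
    by simp
qed

lemma unique_l21_solution_if_sign_matrix_norm_le:
  assumes "full_col_rank_on A n S" "S \<subseteq> {..<N}" "\<forall>j\<in>S. \<sigma> j > 0"
    and norm_le: "\<And>c. norm2S {..<L} (\<lambda>l. \<Sum>j\<in>S. complex_of_real (sign_matrix L \<Phi> j l) * c j)
      \<le> b * norm2S S c"
    and small: "\<forall>m\<in>{..<N} - S. norm2S S (pinvS_apply A n S (\<lambda>i. A i m)) < \<gamma>"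
    and "0 < b" "b * \<gamma> \<le> 1"
  shows "unique_l21_solution A n N L (X_of S \<sigma> \<Phi>)"
proof (rule unique_l21_solution_if_sign_matrix[OF assms(1-3)])
  fix m assume "m \<in> {..<N} - S"
  let ?p = "pinvS_apply A n S (\<lambda>i. A i m)"
  have "norm2S {..<L} (certificate_column A n S (\<lambda>j l. complex_of_real (sign_matrix L \<Phi> j l)) m)
      \<le> b * norm2S S ?p"
    using norm_le[of ?p] by (simp add: certificate_column_def[abs_def])
  also have "\<dots> < b * \<gamma>"
    using small \<open>m \<in> {..<N} - S\<close> \<open>0 < b\<close> by (intro mult_strict_left_mono) auto
  also note \<open>b * \<gamma> \<le> 1\<close>
  finally show "norm2S {..<L} (certificate_column A n S (\<lambda>j l. complex_of_real (sign_matrix L \<Phi> j l)) m) < 1" .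
qed

lemma power2_Gamma_add_half_le:
  fixes x :: real
  assumes "x > 0"
  shows "(Gamma (x + 1 / 2))\<^sup>2 \<le> x * (Gamma x)\<^sup>2"
proof -
  have pos: "0 < Gamma x" "0 < Gamma (x + 1)" "0 < Gamma (x + 1 / 2)"
    using assms by (auto intro!: Gamma_real_pos)
  have "(ln \<circ> Gamma) ((1 - 1 / 2) *\<^sub>R x + (1 / 2) *\<^sub>R (x + 1))
      \<le> (1 - 1 / 2) * (ln \<circ> Gamma) x + 1 / 2 * (ln \<circ> Gamma) (x + 1)"
    using assms by (intro convex_onD[OF log_convex_Gamma_real]) auto
  moreover have "(1 - 1 / 2) *\<^sub>R x + (1 / 2) *\<^sub>R (x + 1) = x + 1 / 2"
    by (simp add: field_simps)
  ultimately have "ln ((Gamma (x + 1 / 2))\<^sup>2) \<le> ln (Gamma x * Gamma (x + 1))"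
    using pos by (simp add: ln_realpow ln_mult_pos)
  then have "(Gamma (x + 1 / 2))\<^sup>2 \<le> Gamma x * Gamma (x + 1)"
    using pos by (simp add: ln_le_cancel_iff)
  also have "Gamma (x + 1) = x * Gamma x"
    using assms by (intro Gamma_plus1) (auto elim!: nonpos_Ints_cases)
  finally show ?thesis by (simp add: power2_eq_square mult_ac)
qed

lemma A_const_le_sqrt:
  assumes "L > 0"
  shows "A_const L \<le> sqrt (real L)"
proof (rule real_le_rsqrt)
  have "(Gamma (real L / 2))\<^sup>2 > 0" using assms by (intro zero_less_power Gamma_real_pos) simp
  then show "(A_const L)\<^sup>2 \<le> real L"
    using power2_Gamma_add_half_le[of "real L / 2"] assms
    by (simp add: A_const_def power_mult_distrib power_divide add_divide_distrib pos_divide_le_eq)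
qed

lemma sqrt_mult_A_const_le:
  assumes "L > 0"
  shows "sqrt (9 + 4 * real k / real L) * (A_const L / (3 * sqrt (real L) + 2 * sqrt (real k))) \<le> 1"
proof -
  have pos: "3 * sqrt (real L) + 2 * sqrt (real k) > 0"
    using assms by (simp add: add_pos_nonneg)
  have "sqrt (9 + 4 * real k / real L) * A_const L \<le> sqrt (9 + 4 * real k / real L) * sqrt (real L)"
    using A_const_le_sqrt[OF assms] by (intro mult_left_mono) auto
  also have "\<dots> = sqrt (9 * real L + 4 * real k)"
    using assms by (simp add: real_sqrt_mult[symmetric] distrib_right)
  also have "\<dots> \<le> sqrt (9 * real L) + sqrt (4 * real k)"
    by (intro sqrt_add_le_add_sqrt) auto
  also have "\<dots> = 3 * sqrt (real L) + 2 * sqrt (real k)"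
    by (simp add: real_sqrt_mult)
  finally show ?thesis
    using pos by (simp add: pos_divide_le_eq)
qed

theorem theorem4:
  fixes A :: "nat \<Rightarrow> nat \<Rightarrow> complex" and n N L k :: nat and S :: "nat set"
    and \<sigma> :: "nat \<Rightarrow> real"
  assumes "S \<subseteq> {..<N}" and "card S = k"
    and "full_col_rank_on A n S"
    and "\<forall>j\<in>S. \<sigma> j > 0"
    and "L > 0"
    and "\<forall>l\<in>{..<N} - S.
           norm2S S (pinvS_apply A n S (\<lambda>i. A i l)) < A_const L / (3 * sqrt (real L) + 2 * sqrt (real k))"
  shows "measure (gauss_entries S L)
            {\<Phi> \<in> space (gauss_entries S L). unique_l21_solution A n N L (X_of S \<sigma> \<Phi>)}
         \<ge> 1 - exp (- real L / 8) - real k * exp (- (A_const L)\<^sup>2 / 8)"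
proof -
  let ?M = "gauss_entries S L"
  let ?recovered = "{\<Phi> \<in> space ?M. unique_l21_solution A n N L (X_of S \<sigma> \<Phi>)}"
  interpret prob_space ?M by (rule prob_space_gauss_entries)
  have "finite S" using assms(1) finite_subset by blast
  then obtain good where good: "good \<in> sets ?M" "1 - exp (- real L / 8) \<le> prob good"
    and norm_le: "\<And>\<Phi> c. \<Phi> \<in> good \<Longrightarrow>
      norm2S {..<L} (\<lambda>l. \<Sum>j\<in>S. complex_of_real (sign_matrix L \<Phi> j l) * c j)
      \<le> sqrt (9 + 4 * real k / real L) * norm2S S c"
    using sign_matrix_norm_event[of S L] assms(2,5) by auto
  have "unique_l21_solution A n N L (X_of S \<sigma> \<Phi>)" if "\<Phi> \<in> good" for \<Phi>
    by (rule unique_l21_solution_if_sign_matrix_norm_le[OF assms(3,1,4) norm_le[OF that] assms(6) _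
          sqrt_mult_A_const_le[OF assms(5)]]) (simp add: add_pos_nonneg)
  then have "prob good \<le> prob ?recovered"
    using sets.sets_into_space[OF good(1)] by (intro finite_measure_mono sets_unique_l21_solution) auto
  moreover have "0 \<le> real k * exp (- (A_const L)\<^sup>2 / 8)" by simp
  ultimately show ?thesis using good(2) by linarith
qed

end
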